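(* Let $\Lambda_R\subseteq\Lambda_1,\Lambda_2\subseteq\Lambda_W$ be intermediate lattices with $\operatorname{Cent}_{\Lambda_R}(\Lambda_1)=\operatorname{Cent}_{\Lambda_R}(\Lambda_2)=:\Lambda'$, let $g\colon\Lambda_1/\Lambda_R\times\Lambda_2/\Lambda_R\to\mathbb C^\times$ be a pairing of groups (also regarded as a function on $\Lambda_1\times\Lambda_2$), and assume that $A_\ell\in\operatorname{End}_{\mathbb Z}(\Lambda_2)$ is a centralizer transfer map for $\Lambda_2$. 1. The following form is well defined on the quotients: $$a_g^\ell\colon\ \Lambda_1/\Lambda_R\times\Lambda_2/\Lambda_R\to\mathbb C^\times,\qquad(\bar\lambda,\bar\mu)\mapsto q^{-(\lambda,A_\ell(\mu))}\cdot g(\lambda,A_\ell(\mu)).$$ 2. Let $\operatorname{Cent}^g_{\Lambda_1}(\Lambda_2):=\{\lambda\in\Lambda_1\mid q^{(\lambda,\mu)}=g(\lambda,\mu)\ \forall\mu\in\Lambda_2\}$. Then the inclusion $\operatorname{Cent}^g_{\Lambda_1}(\Lambda_2)\hookrightarrow\Lambda_1$ induces an isomorphism $$\operatorname{Cent}^g_{\Lambda_1}(\Lambda_2)/\Lambda'\;\cong\;\operatorname{Rad}(a_g^\ell),$$ where $\operatorname{Rad}(a_g^\ell)=\{x\in\Lambda_1/\Lambda_R\mid a_g^\ell(x,y)=1\ \forall y\in\Lambda_2/\Lambda_R\}$.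
   Context: Let $\mathfrak g$ be a finite-dimensional simple complex Lie algebra with simple roots $\alpha_1,\dots,\alpha_n$, and $(\cdot,\cdot)$ the invariant bilinear form normalized so that short roots satisfy $(\alpha,\alpha)=2$; $d_i=(\alpha_i,\alpha_i)/2$. $\Lambda_R$ is the root lattice, $\Lambda_W$ the weight lattice spanned by the $\lambda_i$ with $(\lambda_i,\alpha_j)=\delta_{ij}d_i$. Let $\ell\ge1$ be an integer, $q=\exp(2\pi i/\ell)$ and $q^r:=\exp(2\pi i r/\ell)$ for $r\in\mathbb Q$. For lattices $A,B$ put $\operatorname{Cent}_A(B)=\{\nu\in A\mid(\nu,\mu)\in\ell\mathbb Z\ \forall\mu\in B\}$. A centralizer transfer map for a lattice $\Lambda\supseteq\Lambda_R$ is a group endomorphism $A_\ell\in\operatorname{End}_{\mathbb Z}(\Lambda)$ with $A_\ell(\Lambda)=\operatorname{Cent}_\Lambda(\Lambda_R)$ and $A_\ell(\Lambda_R)=\operatorname{Cent}_{\Lambda_R}(\Lambda)$. *)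

theory Defs
  imports Complex_Main "HOL-Library.Function_Algebras" "HOL-Algebra.Coset"
begin

section \<open>Simple complex Lie algebras\<close>

text \<open>The underlying space is a whole type, with an explicit complex scalar multiplication.\<close>

definition lie_algebra ::
    "(complex \<Rightarrow> 'g::ab_group_add \<Rightarrow> 'g) \<Rightarrow> ('g \<Rightarrow> 'g \<Rightarrow> 'g) \<Rightarrow> bool" where
  "lie_algebra scale br \<longleftrightarrow>
     vector_space scale \<and>
     (\<forall>x. Vector_Spaces.linear scale scale (br x)) \<and>
     (\<forall>y. Vector_Spaces.linear scale scale (\<lambda>x. br x y)) \<and>
     (\<forall>x. br x x = 0) \<and>
     (\<forall>x y z. br x (br y z) + br y (br z x) + br z (br x y) = 0)"

definition finite_dim :: "(complex \<Rightarrow> 'g::ab_group_add \<Rightarrow> 'g) \<Rightarrow> bool" where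
  "finite_dim scale \<longleftrightarrow> (\<exists>S. finite S \<and> module.span scale S = UNIV)"

definition lie_ideal ::
    "(complex \<Rightarrow> 'g::ab_group_add \<Rightarrow> 'g) \<Rightarrow> ('g \<Rightarrow> 'g \<Rightarrow> 'g) \<Rightarrow> 'g set \<Rightarrow> bool" where
  "lie_ideal scale br I \<longleftrightarrow> module.subspace scale I \<and> (\<forall>x. \<forall>y\<in>I. br x y \<in> I)"

definition simple_lie_algebra ::
    "(complex \<Rightarrow> 'g::ab_group_add \<Rightarrow> 'g) \<Rightarrow> ('g \<Rightarrow> 'g \<Rightarrow> 'g) \<Rightarrow> bool" where
  "simple_lie_algebra scale br \<longleftrightarrow>
     lie_algebra scale br \<and> (\<exists>x y. br x y \<noteq> 0) \<and>
     (\<forall>I. lie_ideal scale br I \<longrightarrow> I = {0} \<or> I = UNIV)"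

text \<open>For semisimple \<open>\<gg>\<close>, a Cartan subalgebra is a maximal abelian subalgebra all of whose
  elements are ad-diagonalizable.\<close>

definition cartan_subalgebra ::
    "(complex \<Rightarrow> 'g::ab_group_add \<Rightarrow> 'g) \<Rightarrow> ('g \<Rightarrow> 'g \<Rightarrow> 'g) \<Rightarrow> 'g set \<Rightarrow> bool" where
  "cartan_subalgebra scale br H \<longleftrightarrow>
     module.subspace scale H \<and>
     (\<forall>h\<in>H. \<forall>h'\<in>H. br h h' = 0) \<and>
     (\<forall>x. (\<forall>h\<in>H. br h x = 0) \<longrightarrow> x \<in> H) \<and>
     (\<forall>h\<in>H. module.span scale {v. \<exists>c. br h v = scale c v} = UNIV)"


section \<open>Roots, the invariant form and weights\<close>

text \<open>A linear functional on \<open>H\<close> is represented by its extension by \<open>0\<close> outside \<open>H\<close>, so that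
  equality of functionals is equality of functions and the pointwise operations of
  Function_Algebras are those of the dual space.\<close>

definition dual_space ::
    "(complex \<Rightarrow> 'g::ab_group_add \<Rightarrow> 'g) \<Rightarrow> 'g set \<Rightarrow> ('g \<Rightarrow> complex) set" where
  "dual_space scale H =
     {f. (\<forall>x\<in>H. \<forall>y\<in>H. f (x + y) = f x + f y) \<and>
         (\<forall>c. \<forall>x\<in>H. f (scale c x) = c * f x) \<and>
         (\<forall>x. x \<notin> H \<longrightarrow> f x = 0)}"

definition roots ::
    "(complex \<Rightarrow> 'g::ab_group_add \<Rightarrow> 'g) \<Rightarrow> ('g \<Rightarrow> 'g \<Rightarrow> 'g) \<Rightarrow> 'g set \<Rightarrow> ('g \<Rightarrow> complex) set" where
  "roots scale br H =
     {\<beta> \<in> dual_space scale H. \<beta> \<noteq> 0 \<and> (\<exists>x. x \<noteq> 0 \<and> (\<forall>h\<in>H. br h x = scale (\<beta> h) x))}"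

text \<open>The scalar multiplication in the independence condition is the pointwise one on
  functionals.\<close>

definition simple_roots ::
    "('g \<Rightarrow> complex) set \<Rightarrow> nat \<Rightarrow> (nat \<Rightarrow> 'g \<Rightarrow> complex) \<Rightarrow> bool" where
  "simple_roots \<Phi> n \<alpha> \<longleftrightarrow>
     \<alpha> ` {1..n} \<subseteq> \<Phi> \<and> inj_on \<alpha> {1..n} \<and>
     \<not> module.dependent (\<lambda>(c::complex) f x. c * f x) (\<alpha> ` {1..n}) \<and>
     (\<forall>\<beta>\<in>\<Phi>. \<exists>k :: nat \<Rightarrow> nat. \<beta> = (\<lambda>x. \<Sum>i = 1..n. of_nat (k i) * \<alpha> i x) \<or>
                               \<beta> = (\<lambda>x. - (\<Sum>i = 1..n. of_nat (k i) * \<alpha> i x)))"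

definition invariant_form ::
    "(complex \<Rightarrow> 'g::ab_group_add \<Rightarrow> 'g) \<Rightarrow> ('g \<Rightarrow> 'g \<Rightarrow> 'g) \<Rightarrow> ('g \<Rightarrow> 'g \<Rightarrow> complex) \<Rightarrow> bool" where
  "invariant_form scale br B \<longleftrightarrow>
     (\<forall>x. Vector_Spaces.linear scale (*) (B x)) \<and>
     (\<forall>x y. B x y = B y x) \<and>
     (\<forall>x y z. B (br x y) z = B x (br y z)) \<and>
     (\<forall>x. (\<forall>y. B x y = 0) \<longrightarrow> x = 0)"

text \<open>The form on the dual space transported along the isomorphism \<open>t \<mapsto> B t\<close> from \<open>H\<close>, which is
  bijective because an invariant form restricts to a nondegenerate form on a Cartan subalgebra.\<close>

definition dual_form ::
    "'g set \<Rightarrow> ('g \<Rightarrow> 'g \<Rightarrow> complex) \<Rightarrow> ('g \<Rightarrow> complex) \<Rightarrow> ('g \<Rightarrow> complex) \<Rightarrow> complex" where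
  "dual_form H B \<mu> \<nu> =
     (let t = (\<lambda>f. THE t. t \<in> H \<and> (\<forall>h\<in>H. B t h = f h)) in B (t \<mu>) (t \<nu>))"

text \<open>An invariant form is unique only up to a complex factor; before normalization the values
  \<open>(\<beta>, \<beta>)\<close> at roots are positive reals times a common factor, so lengths are compared through
  the absolute value. If all roots have the same length, all of them are short.\<close>

definition short_root ::
    "('g \<Rightarrow> complex) set \<Rightarrow> (('g \<Rightarrow> complex) \<Rightarrow> ('g \<Rightarrow> complex) \<Rightarrow> complex) \<Rightarrow>
     ('g \<Rightarrow> complex) \<Rightarrow> bool" where
  "short_root \<Phi> ip \<beta> \<longleftrightarrow> \<beta> \<in> \<Phi> \<and> (\<forall>\<gamma>\<in>\<Phi>. cmod (ip \<beta> \<beta>) \<le> cmod (ip \<gamma> \<gamma>))"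

definition normalized_form ::
    "('g \<Rightarrow> complex) set \<Rightarrow> (('g \<Rightarrow> complex) \<Rightarrow> ('g \<Rightarrow> complex) \<Rightarrow> complex) \<Rightarrow> bool" where
  "normalized_form \<Phi> ip \<longleftrightarrow> (\<forall>\<beta>. short_root \<Phi> ip \<beta> \<longrightarrow> ip \<beta> \<beta> = 2)"

definition fundamental_weights ::
    "('g \<Rightarrow> complex) set \<Rightarrow> (('g \<Rightarrow> complex) \<Rightarrow> ('g \<Rightarrow> complex) \<Rightarrow> complex) \<Rightarrow>
     nat \<Rightarrow> (nat \<Rightarrow> 'g \<Rightarrow> complex) \<Rightarrow> (nat \<Rightarrow> 'g \<Rightarrow> complex) \<Rightarrow> bool" where
  "fundamental_weights D ip n \<alpha> \<omega> \<longleftrightarrow>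
     (\<forall>i\<in>{1..n}. \<omega> i \<in> D \<and>
        (\<forall>j\<in>{1..n}. ip (\<omega> i) (\<alpha> j) = (if i = j then ip (\<alpha> i) (\<alpha> i) / 2 else 0)))"

definition int_span :: "nat \<Rightarrow> (nat \<Rightarrow> 'g \<Rightarrow> complex) \<Rightarrow> ('g \<Rightarrow> complex) set" where
  "int_span n v = range (\<lambda>k :: nat \<Rightarrow> int. \<lambda>x. \<Sum>i = 1..n. of_int (k i) * v i x)"


section \<open>Lattices, centralizers and pairings\<close>

definition add_grp :: "'v::ab_group_add set \<Rightarrow> 'v monoid" where
  "add_grp L = \<lparr>carrier = L, mult = (+), one = 0\<rparr>"

definition intermediate_lattice :: "'v::ab_group_add set \<Rightarrow> 'v set \<Rightarrow> 'v set \<Rightarrow> bool" where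
  "intermediate_lattice R W L \<longleftrightarrow> R \<subseteq> L \<and> L \<subseteq> W \<and> subgroup L (add_grp UNIV)"

definition quot :: "'v::ab_group_add set \<Rightarrow> 'v set \<Rightarrow> 'v set monoid" where
  "quot L N = add_grp L Mod N"

definition cls :: "'v::ab_group_add set \<Rightarrow> 'v \<Rightarrow> 'v set" where
  "cls N v = N #>\<^bsub>add_grp UNIV\<^esub> v"

definition cent :: "nat \<Rightarrow> ('v \<Rightarrow> 'v \<Rightarrow> complex) \<Rightarrow> 'v set \<Rightarrow> 'v set \<Rightarrow> 'v set" where
  "cent l ip A B = {\<nu> \<in> A. \<forall>\<mu>\<in>B. \<exists>k :: int. ip \<nu> \<mu> = of_nat l * of_int k}"

text \<open>\<open>q ^ r\<close> for \<open>q = exp (2 \<pi> \<i> / l)\<close>. The exponent is typed as complex because the form on the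
  dual of \<open>H\<close> is complex-valued; on the weight lattice its values are rational.\<close>

definition qpow :: "nat \<Rightarrow> complex \<Rightarrow> complex" where
  "qpow l r = exp (2 * of_real pi * \<i> * r / of_nat l)"

definition centralizer_transfer ::
    "nat \<Rightarrow> ('v::ab_group_add \<Rightarrow> 'v \<Rightarrow> complex) \<Rightarrow> 'v set \<Rightarrow> 'v set \<Rightarrow> ('v \<Rightarrow> 'v) \<Rightarrow> bool" where
  "centralizer_transfer l ip R L A \<longleftrightarrow>
     A \<in> hom (add_grp L) (add_grp L) \<and>
     A ` L = cent l ip L R \<and> A ` R = cent l ip R L"

definition complex_units :: "complex monoid" where
  "complex_units = \<lparr>carrier = UNIV - {0}, mult = (*), one = 1\<rparr>"

definition pairing :: "'x monoid \<Rightarrow> 'y monoid \<Rightarrow> ('x \<Rightarrow> 'y \<Rightarrow> complex) \<Rightarrow> bool" where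
  "pairing G K g \<longleftrightarrow>
     (\<forall>x\<in>carrier G. (\<lambda>y. g x y) \<in> hom K complex_units) \<and>
     (\<forall>y\<in>carrier K. (\<lambda>x. g x y) \<in> hom G complex_units)"

text \<open>The function on pairs of classes induced by a function \<open>F\<close> of representatives. It has the
  intended values exactly when \<open>F\<close> is constant on pairs of classes.\<close>

definition descend :: "('v \<Rightarrow> 'v \<Rightarrow> complex) \<Rightarrow> 'v set \<Rightarrow> 'v set \<Rightarrow> complex" where
  "descend F X Y = (THE z. \<forall>\<nu>\<in>X. \<forall>\<mu>\<in>Y. F \<nu> \<mu> = z)"

definition a_form_rep ::
    "nat \<Rightarrow> ('v::ab_group_add \<Rightarrow> 'v \<Rightarrow> complex) \<Rightarrow> 'v set \<Rightarrow> ('v set \<Rightarrow> 'v set \<Rightarrow> complex) \<Rightarrow>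
     ('v \<Rightarrow> 'v) \<Rightarrow> 'v \<Rightarrow> 'v \<Rightarrow> complex" where
  "a_form_rep l ip R g A \<nu> \<mu> = qpow l (- ip \<nu> (A \<mu>)) * g (cls R \<nu>) (cls R (A \<mu>))"

definition a_form ::
    "nat \<Rightarrow> ('v::ab_group_add \<Rightarrow> 'v \<Rightarrow> complex) \<Rightarrow> 'v set \<Rightarrow> ('v set \<Rightarrow> 'v set \<Rightarrow> complex) \<Rightarrow>
     ('v \<Rightarrow> 'v) \<Rightarrow> 'v set \<Rightarrow> 'v set \<Rightarrow> complex" where
  "a_form l ip R g A = descend (a_form_rep l ip R g A)"

definition cent_g ::
    "nat \<Rightarrow> ('v::ab_group_add \<Rightarrow> 'v \<Rightarrow> complex) \<Rightarrow> 'v set \<Rightarrow> ('v set \<Rightarrow> 'v set \<Rightarrow> complex) \<Rightarrow>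
     'v set \<Rightarrow> 'v set \<Rightarrow> 'v set" where
  "cent_g l ip R g L1 L2 = {\<nu> \<in> L1. \<forall>\<mu>\<in>L2. qpow l (ip \<nu> \<mu>) = g (cls R \<nu>) (cls R \<mu>)}"

definition radical :: "'x monoid \<Rightarrow> 'y monoid \<Rightarrow> ('x \<Rightarrow> 'y \<Rightarrow> complex) \<Rightarrow> 'x set" where
  "radical G K a = {x \<in> carrier G. \<forall>y\<in>carrier K. a x y = 1}"

end

theory Submission
  imports Defs
begin

text \<open>
  Both parts of the theorem rest on the function \<open>a_rep \<nu> \<mu> = q^(- (\<nu>, A \<mu>)) * g \<nu> (A \<mu>)\<close> of representatives,
  which is multiplicative in each argument. It descends to the quotients because it is trivial when
  one argument lies in \<open>R\<close>: for \<open>\<nu>\<close> in \<open>R\<close> the element \<open>A \<mu>\<close> centralizes \<open>R\<close>; for \<open>\<mu>\<close> in \<open>R\<close> the element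
  \<open>A \<mu>\<close> lies in \<open>R\<close> and centralizes \<open>L2\<close>, hence also \<open>L1\<close>, as the two centralizers agree.

  An element of \<open>C\<close> clearly gives a radical class, and \<open>C \<inter> R = L'\<close> because \<open>g\<close> is trivial on \<open>R\<close>. What needs
  an argument is that every radical class meets \<open>C\<close> (\<open>radical_lift\<close>). Let \<open>\<nu>\<close> represent a radical class. The character
  \<open>\<mu> \<mapsto> q^(- (\<nu>, \<mu>)) * g \<nu> \<mu>\<close> of \<open>L2\<close> is trivial on \<open>A L2\<close>, which is the centralizer of \<open>R\<close> in \<open>L2\<close>. If it has the form
  \<open>\<mu> \<mapsto> q^(\<beta>, \<mu>)\<close> with \<open>\<beta>\<close> in \<open>R\<close>, then \<open>\<nu> + \<beta>\<close> is in the same class and lies in \<open>C\<close>.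

  So a duality statement is needed: a character of \<open>L2\<close> that is trivial on the common kernel of
  the characters \<open>\<mu> \<mapsto> q^(\<beta>, \<mu>)\<close>, with \<open>\<beta>\<close> in \<open>R\<close>, is one of them. This holds when these characters
  have values in the \<open>N\<close>-th roots of unity for some \<open>N\<close>
  (\<open>character_trivial_on_common_kernel\<close>). It fails in general without such a bound, so the rationality of the form on
  \<open>R \<times> W\<close> matters. As \<open>(\<alpha>\<^sub>j, \<omega>\<^sub>i)\<close> is \<open>(\<alpha>\<^sub>i, \<alpha>\<^sub>i) / 2\<close> or \<open>0\<close>, and short roots have square length \<open>2\<close>, it is enough
  that the ratio of the square lengths of two roots is rational.

  This is where the Lie algebra enters. The form is nondegenerate on \<open>H\<close>, by the root space
  decomposition, so functionals on \<open>H\<close> are represented by vectors of \<open>H\<close>. A highest vector of a root string, moved by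
  a pair \<open>x, y\<close> of root vectors with \<open>[x, y]\<close> representing \<open>\<alpha>\<close>, shows that \<open>(\<beta>, \<alpha>)\<close> is a rational multiple of
  \<open>(\<alpha>, \<alpha>)\<close> (\<open>root_pairing_rational\<close>). Hence no root is isotropic, two roots that are not orthogonal have a rational
  length ratio, and the roots whose length is commensurable with that of a given root generate an ideal
  orthogonal to all other roots. By simplicity there are no other roots (\<open>rational_root_length_ratio\<close>).
\<close>

section \<open>Characters trivial on a common kernel\<close>

lemma qpow_add: "qpow l (y + z) = qpow l y * qpow l z"
  by (simp add: qpow_def exp_add[symmetric] add_divide_distrib distrib_left)

lemma qpow_0 [simp]: "qpow l 0 = 1"
  by (simp add: qpow_def)

lemma qpow_nonzero [simp]: "qpow l z \<noteq> 0"
  by (simp add: qpow_def)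

lemma qpow_minus: "qpow l (- z) = inverse (qpow l z)"
  using qpow_add[of l "- z" z] inverse_unique[of "qpow l z" "qpow l (- z)"] by (simp add: mult.commute)

lemma qpow_diff: "qpow l (y - z) = qpow l y / qpow l z"
  using qpow_add[of l y "- z"] by (simp add: qpow_minus divide_inverse)

text \<open>The real part of \<open>z\<close> vanishes because \<open>exp z\<close> has norm \<open>1\<close>; the imaginary part is then read off from the cosine.\<close>

lemma exp_eq_1_iff_multiple_2pi:
  fixes z :: complex
  shows "exp z = 1 \<longleftrightarrow> (\<exists>m::int. z = 2 * of_real pi * \<i> * of_int m)"
proof
  assume exp: "exp z = 1"
  then have "exp (Re z) = 1" by (metis norm_exp_eq_Re norm_one)
  then have "Re z = 0" by simp
  then have "z = \<i> * of_real (Im z)" by (simp add: complex_eq_iff)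
  then have "cis (Im z) = 1" using exp by (metis cis_conv_exp)
  then have "cos (Im z) = 1" by (metis cis.sel(1) one_complex.sel(1))
  then obtain m :: int where "Im z = m * 2 * pi" by (auto simp: cos_one_2pi_int)
  then have "z = 2 * of_real pi * \<i> * of_int m" using \<open>Re z = 0\<close> by (simp add: complex_eq_iff)
  then show "\<exists>m::int. z = 2 * of_real pi * \<i> * of_int m" ..
next
  assume "\<exists>m::int. z = 2 * of_real pi * \<i> * of_int m"
  then obtain m :: int where "z = \<i> * of_real (2 * pi * of_int m)" by (auto simp: algebra_simps)
  then have "exp z = cis (2 * pi * of_int m)" by (simp only: cis_conv_exp)
  then show "exp z = 1" by simp
qed

text \<open>This turns triviality of \<open>q^(\<nu>, \<mu>)\<close> into membership of \<open>(\<nu>, \<mu>)\<close> in \<open>l \<int>\<close>, also for exponents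
  that are not known to be real.\<close>

lemma qpow_eq_1_iff:
  assumes "l > 0"
  shows "qpow l z = 1 \<longleftrightarrow> (\<exists>k::int. z = of_nat l * of_int k)"
proof -
  have "2 * of_real pi * \<i> * z / of_nat l = 2 * of_real pi * \<i> * of_int m \<longleftrightarrow> z = of_nat l * of_int m"
    for m :: int
    using assms by (simp add: divide_eq_eq mult.assoc mult.commute[of _ "of_nat l"])
  then show ?thesis unfolding qpow_def exp_eq_1_iff_multiple_2pi by simp
qed

text \<open>The \<open>k\<close>-th power of the chosen primitive \<open>N\<close>-th root of unity.\<close>

abbreviation unity_power :: "nat \<Rightarrow> int \<Rightarrow> complex" where
  "unity_power N k \<equiv> qpow N (of_int k)"

lemma unity_power_add: "unity_power N (j + k) = unity_power N j * unity_power N k"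
  by (simp add: qpow_add)

lemma unity_power_eq_1_iff:
  assumes "N > 0"
  shows "unity_power N k = 1 \<longleftrightarrow> int N dvd k"
proof -
  have "complex_of_int k = of_nat N * of_int m \<longleftrightarrow> k = int N * m" for m
    by (metis of_int_eq_iff of_int_mult of_int_of_nat_eq)
  then show ?thesis using assms by (simp add: qpow_eq_1_iff dvd_def)
qed

lemma unity_power_cong:
  assumes "N > 0" "int N dvd j - k"
  shows "unity_power N j = unity_power N k"
  using unity_power_add[of N "j - k" k] unity_power_eq_1_iff[of N "j - k"] assms by simp

text \<open>The generator is the least positive element: the remainder of any element modulo it lies in
  the set and is smaller.\<close>

lemma int_subgroup_principal:
  fixes S :: "int set" and N :: nat
  assumes diff: "\<And>j k. j \<in> S \<Longrightarrow> k \<in> S \<Longrightarrow> j - k \<in> S" and N: "int N \<in> S" "N > 0"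
  obtains d :: nat where "d > 0" "int d \<in> S" "\<And>k. k \<in> S \<Longrightarrow> int d dvd k"
proof -
  define d where "d = (LEAST d::nat. d > 0 \<and> int d \<in> S)"
  have d: "d > 0" "int d \<in> S"
    using LeastI[of "\<lambda>d::nat. d > 0 \<and> int d \<in> S" N] N by (auto simp: d_def)
  have zero: "0 \<in> S" using diff[OF N(1) N(1)] by simp
  have neg: "- k \<in> S" if "k \<in> S" for k using diff[OF zero that] by simp
  have mult_nat: "int m * int d \<in> S" for m
  proof (induction m)
    case (Suc m)
    show ?case using diff[OF Suc.IH neg[OF d(2)]] by (simp add: algebra_simps)
  qed (simp add: zero)
  have mult: "m * int d \<in> S" for m :: int
    using mult_nat[of "nat m"] neg[OF mult_nat[of "nat (- m)"]] by (cases "m \<ge> 0") auto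
  have "int d dvd k" if k: "k \<in> S" for k
  proof (rule ccontr)
    assume "\<not> int d dvd k"
    then have "k mod int d \<noteq> 0" by (simp add: mod_eq_0_iff_dvd)
    moreover have "k mod int d \<ge> 0" using d(1) by simp
    ultimately have pos: "k mod int d > 0" by linarith
    have "k mod int d \<in> S" using diff[OF k mult[of "k div int d"]] by (simp add: minus_div_mult_eq_mod)
    then have "0 < nat (k mod int d) \<and> int (nat (k mod int d)) \<in> S" using pos by simp
    then have "d \<le> nat (k mod int d)"
      using Least_le[of "\<lambda>d. 0 < d \<and> int d \<in> S", folded d_def] by blast
    moreover have "k mod int d < int d" using d(1) by simp
    ultimately show False using pos by linarith
  qed
  then show ?thesis using d that by blast
qed

text \<open>A character that factors through a subgroup of the cyclic group of order \<open>N\<close> is a power of the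
  standard one. The values of \<open>f\<close> modulo \<open>N\<close> are the multiples of a divisor \<open>d\<close> of \<open>N\<close>, so \<open>\<chi>\<close> is determined by its value at
  an \<open>x0\<close> with \<open>f x0\<close> congruent to \<open>d\<close>, and this value is a root of unity of order dividing \<open>M = N / d\<close>.\<close>

lemma character_trivial_on_kernel:
  fixes L :: "'v::ab_group_add set" and \<chi> :: "'v \<Rightarrow> complex" and f :: "'v \<Rightarrow> int"
  assumes N: "N > 0" and zero: "0 \<in> L" and diff: "\<And>x y. x \<in> L \<Longrightarrow> y \<in> L \<Longrightarrow> x - y \<in> L"
    and \<chi>: "\<And>x y. x \<in> L \<Longrightarrow> y \<in> L \<Longrightarrow> \<chi> (x + y) = \<chi> x * \<chi> y"
    and f: "\<And>x y. x \<in> L \<Longrightarrow> y \<in> L \<Longrightarrow> f (x + y) = f x + f y"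
    and triv: "\<And>x. x \<in> L \<Longrightarrow> int N dvd f x \<Longrightarrow> \<chi> x = 1"
  shows "\<exists>c. \<forall>x\<in>L. \<chi> x = unity_power N (c * f x)"
proof -
  have f0: "f 0 = 0" using f[OF zero zero] by simp
  have fdiff: "f (x - y) = f x - f y" if "x \<in> L" "y \<in> L" for x y
    using f[OF diff[OF that] that(2)] by simp
  define S where "S = {k. \<exists>x\<in>L. int N dvd f x - k}"
  have "j - k \<in> S" if jk: "j \<in> S" "k \<in> S" for j k
  proof -
    obtain x y where "x \<in> L" "y \<in> L" "int N dvd f x - j" "int N dvd f y - k"
      using jk by (auto simp: S_def)
    moreover from this have "int N dvd (f x - j) - (f y - k)" by (blast intro: dvd_diff)
    moreover have "(f x - j) - (f y - k) = (f x - f y) - (j - k)" by simp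
    ultimately show ?thesis
      unfolding S_def by (auto intro!: bexI[of _ "x - y"] simp: diff fdiff)
  qed
  moreover have "int N \<in> S" using zero unfolding S_def by (auto intro!: bexI[of _ 0] simp: f0)
  ultimately obtain d where d: "d > 0" "int d \<in> S" "\<And>k. k \<in> S \<Longrightarrow> int d dvd k"
    using int_subgroup_principal[of S N] N by blast
  obtain x0 where x0: "x0 \<in> L" "int N dvd f x0 - int d" using d(2) by (auto simp: S_def)
  have "int d dvd int N" by (rule d(3)) fact
  then obtain M where M: "N = d * M" by auto
  have M_pos: "M > 0" using N M by simp
  \<comment> \<open>If \<open>f x\<close> is congruent to \<open>m d\<close>, then subtracting \<open>x0\<close> from \<open>x\<close> exactly \<open>m\<close> times reaches the kernel.\<close>
  have power: "\<chi> x = \<chi> x0 ^ m" if "x \<in> L" "int N dvd f x - int m * int d" for x m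
    using that
  proof (induction m arbitrary: x)
    case 0
    then show ?case using triv by simp
  next
    case (Suc m)
    have "int N dvd (f x - int (Suc m) * int d) - (f x0 - int d)"
      using Suc.prems(2) x0(2) by (rule dvd_diff)
    then have "\<chi> (x - x0) = \<chi> x0 ^ m"
      using Suc.prems(1) x0(1) by (intro Suc.IH) (simp_all add: diff fdiff algebra_simps)
    then show ?case using \<chi>[OF diff[OF Suc.prems(1) x0(1)] x0(1)] by simp
  qed
  have "\<chi> 0 = \<chi> x0 ^ M" by (rule power) (simp_all add: zero f0 M mult.commute)
  then have "\<chi> x0 ^ M = 1" using triv[OF zero] f0 by simp
  then obtain c where c: "\<chi> x0 = cis (2 * pi * real c / real M)"
    using bij_betw_roots_unity[OF M_pos] unfolding bij_betw_def by blast
  have c_eq: "\<chi> x0 = unity_power N (int c * int d)"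
    using d(1) M_pos by (simp add: c cis_conv_exp qpow_def M field_simps)
  have pow_eq: "\<chi> x0 ^ m = unity_power N (int c * (int m * int d))" for m
    by (induction m) (simp_all add: c_eq algebra_simps qpow_add)
  have "\<chi> x = unity_power N (int c * f x)" if x: "x \<in> L" for x
  proof -
    have "f x \<in> S" unfolding S_def using x by (intro CollectI bexI[of _ x]) simp_all
    then obtain k where k: "f x = int d * k" using d(3) unfolding dvd_def by blast
    \<comment> \<open>Reducing modulo \<open>M\<close> changes \<open>f x\<close> by a multiple of \<open>N = d M\<close> and makes the exponent a natural number.\<close>
    define m where "m = nat (k mod int M)"
    have m: "int m = k mod int M" using M_pos by (simp add: m_def)
    have "f x - int m * int d = int N * (k div int M)"
    proof -
      have "f x - int m * int d = int d * (k - k mod int M)"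
        by (simp only: k m right_diff_distrib mult.commute)
      also have "k - k mod int M = int M * (k div int M)" by (rule minus_mod_eq_mult_div)
      finally show ?thesis by (simp add: M)
    qed
    then have dvd: "int N dvd f x - int m * int d" by simp
    have "int c * f x - int c * (int m * int d) = int c * (f x - int m * int d)"
      by (simp add: algebra_simps)
    then have "int N dvd int c * f x - int c * (int m * int d)" using dvd by simp
    then have "unity_power N (int c * f x) = unity_power N (int c * (int m * int d))"
      by (rule unity_power_cong[OF N])
    then show ?thesis by (simp only: power[OF x dvd] pow_eq)
  qed
  then show ?thesis by blast
qed

text \<open>Duality for characters of bounded order, without passing to a finite quotient: induction on the
  number of functions. On the kernel of the new \<open>f j\<close> the character is known by the induction hypothesis, and after
  division by that expression it is trivial on this kernel, so that the case of one function applies.\<close>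

lemma character_trivial_on_common_kernel:
  fixes L :: "'v::ab_group_add set" and \<chi> :: "'v \<Rightarrow> complex" and f :: "'j \<Rightarrow> 'v \<Rightarrow> int"
  assumes "finite J" and N: "N > 0"
    and "0 \<in> L" and "\<And>x y. x \<in> L \<Longrightarrow> y \<in> L \<Longrightarrow> x - y \<in> L"
    and "\<And>x y. x \<in> L \<Longrightarrow> y \<in> L \<Longrightarrow> \<chi> (x + y) = \<chi> x * \<chi> y"
    and "\<And>j x y. x \<in> L \<Longrightarrow> y \<in> L \<Longrightarrow> f j (x + y) = f j x + f j y"
    and "\<And>x. x \<in> L \<Longrightarrow> (\<And>j. j \<in> J \<Longrightarrow> int N dvd f j x) \<Longrightarrow> \<chi> x = 1"
  shows "\<exists>b. \<forall>x\<in>L. \<chi> x = unity_power N (\<Sum>j\<in>J. b j * f j x)"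
  using assms(1,3-)
proof (induction J arbitrary: L rule: finite_induct)
  case empty
  then show ?case by simp
next
  case (insert j J)
  note zero = insert.prems(1) and diff = insert.prems(2) and \<chi> = insert.prems(3)
    and f = insert.prems(4)
  have f0: "f i 0 = 0" for i using f[OF zero zero, of i] by simp
  have fdiff: "f i (x - y) = f i x - f i y" if "x \<in> L" "y \<in> L" for x y i
    using f[OF diff[OF that] that(2), of i] by simp
  let ?K = "{x \<in> L. int N dvd f j x}"
  have "\<exists>b. \<forall>x\<in>?K. \<chi> x = unity_power N (\<Sum>j\<in>J. b j * f j x)"
  proof (rule insert.IH)
    fix x assume "x \<in> ?K" "\<And>i. i \<in> J \<Longrightarrow> int N dvd f i x"
    then show "\<chi> x = 1" using insert.prems(5) by auto
  qed (use zero diff \<chi> f f0 fdiff in \<open>auto\<close>)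
  then obtain b where b: "\<And>x. x \<in> ?K \<Longrightarrow> \<chi> x = unity_power N (\<Sum>j\<in>J. b j * f j x)" by blast
  define s where "s x = (\<Sum>j\<in>J. b j * f j x)" for x
  have s: "s (x + y) = s x + s y" if "x \<in> L" "y \<in> L" for x y
    by (simp add: s_def f that distrib_left sum.distrib)
  have "\<exists>c. \<forall>x\<in>L. \<chi> x / unity_power N (s x) = unity_power N (c * f j x)"
    by (rule character_trivial_on_kernel[OF N zero diff])
      (auto simp: \<chi> f s qpow_add b[folded s_def])
  then obtain c where c: "\<And>x. x \<in> L \<Longrightarrow> \<chi> x / unity_power N (s x) = unity_power N (c * f j x)" by blast
  have "\<chi> x = unity_power N (\<Sum>i\<in>insert j J. (b(j := c)) i * f i x)" if x: "x \<in> L" for x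
  proof -
    have "(\<Sum>i\<in>insert j J. (b(j := c)) i * f i x) = c * f j x + s x"
      using insert.hyps by (auto simp: s_def intro!: sum.cong)
    moreover have "\<chi> x = unity_power N (c * f j x) * unity_power N (s x)"
      using c[OF x] by (simp add: nonzero_divide_eq_eq)
    ultimately show ?thesis by (simp only: unity_power_add)
  qed
  then show ?case by blast
qed

section \<open>Quotients of additive groups\<close>

lemma comm_group_add_grp_UNIV: "comm_group (add_grp (UNIV :: 'v::ab_group_add set))"
  by (rule comm_groupI) (auto simp: add_grp_def algebra_simps intro: exI[of _ "- x" for x])

lemma inv_add_grp_UNIV: "inv\<^bsub>add_grp UNIV\<^esub> x = - x"
proof -
  interpret comm_group "add_grp (UNIV :: 'a set)" by (rule comm_group_add_grp_UNIV)
  show ?thesis by (rule inv_equality) (simp_all add: add_grp_def)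
qed

lemma add_subgroupD:
  assumes "subgroup L (add_grp UNIV)"
  shows add_subgroup_zero: "0 \<in> L"
    and add_subgroup_add: "\<And>x y. x \<in> L \<Longrightarrow> y \<in> L \<Longrightarrow> x + y \<in> L"
    and add_subgroup_minus: "\<And>x. x \<in> L \<Longrightarrow> - x \<in> L"
  using subgroup.one_closed[OF assms] subgroup.m_closed[OF assms] subgroup.m_inv_closed[OF assms]
  by (simp_all add: inv_add_grp_UNIV) (simp_all add: add_grp_def)

lemma add_subgroup_diff:
  fixes x :: "'v::ab_group_add"
  assumes "subgroup L (add_grp UNIV)" "x \<in> L" "y \<in> L"
  shows "x - y \<in> L"
  using add_subgroup_add[OF assms(1,2) add_subgroup_minus[OF assms(1,3)]] by simp

lemma add_subgroupI:
  fixes L :: "'v::ab_group_add set"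
  assumes "0 \<in> L" and diff: "\<And>x y. x \<in> L \<Longrightarrow> y \<in> L \<Longrightarrow> x - y \<in> L"
  shows "subgroup L (add_grp UNIV)"
proof -
  interpret comm_group "add_grp (UNIV :: 'v set)" by (rule comm_group_add_grp_UNIV)
  have minus: "- x \<in> L" if "x \<in> L" for x using diff[OF assms(1) that] by simp
  show ?thesis
  proof (rule subgroupI)
    show "x \<otimes>\<^bsub>add_grp UNIV\<^esub> y \<in> L" if "x \<in> L" "y \<in> L" for x y
      using diff[OF that(1) minus[OF that(2)]] by (simp add: add_grp_def)
    show "inv\<^bsub>add_grp UNIV\<^esub> x \<in> L" if "x \<in> L" for x
      using minus[OF that] by (simp add: inv_add_grp_UNIV)
  qed (use assms(1) in \<open>auto simp: add_grp_def\<close>)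
qed

lemma add_grp_restrict: "add_grp L = add_grp UNIV \<lparr>carrier := L\<rparr>"
  by (simp add: add_grp_def)

lemma comm_group_add_grp:
  assumes "subgroup L (add_grp UNIV)"
  shows "comm_group (add_grp L)"
  by (rule comm_groupI)
    (auto simp: add_grp_def algebra_simps add_subgroupD[OF assms]
      intro: bexI[OF _ add_subgroup_minus[OF assms]])

lemma subgroup_add_grp:
  assumes "subgroup L (add_grp UNIV)" "subgroup M (add_grp UNIV)" "L \<subseteq> M"
  shows "subgroup L (add_grp M)"
  unfolding add_grp_restrict[of M]
  using assms comm_group_add_grp_UNIV
  by (intro group.subgroup_incl) (auto simp: comm_group_def)

lemma cls_alt: "cls N v = (\<lambda>h. h + v) ` N"
  by (auto simp: cls_def r_coset_def add_grp_def)

lemma mem_cls_iff: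
  fixes x :: "'v::ab_group_add"
  shows "x \<in> cls N v \<longleftrightarrow> x - v \<in> N"
  unfolding cls_alt by (auto intro: image_eqI[of _ _ "x - v"])

lemma cls_zero: "cls N 0 = N"
  by (simp add: cls_alt)

lemma cls_eq_iff:
  assumes N: "subgroup N (add_grp UNIV)"
  shows "cls N x = cls N y \<longleftrightarrow> x - y \<in> N"
proof
  assume "cls N x = cls N y"
  moreover have "x \<in> cls N x" using add_subgroup_zero[OF N] by (simp add: mem_cls_iff)
  ultimately show "x - y \<in> N" by (simp add: mem_cls_iff)
next
  assume xy: "x - y \<in> N"
  have "z - x \<in> N \<longleftrightarrow> z - y \<in> N" for z
    using add_subgroup_add[OF N, of "z - x" "x - y"] add_subgroup_diff[OF N, of "z - y" "x - y"] xy
    by auto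
  then show "cls N x = cls N y" by (auto simp: mem_cls_iff)
qed

lemma carrier_quot: "carrier (quot L N) = cls N ` L"
  by (auto simp: quot_def carrier_FactGroup cls_def add_grp_def r_coset_def)

lemma one_quot: "\<one>\<^bsub>quot L N\<^esub> = N"
  by (simp add: quot_def)

context
  fixes L N :: "'v::ab_group_add set"
  assumes L: "subgroup L (add_grp UNIV)" and N: "subgroup N (add_grp UNIV)" and NL: "N \<subseteq> L"
begin

lemma normal_add_grp: "N \<lhd> add_grp L"
  by (rule comm_group.subgroup_imp_normal[OF comm_group_add_grp[OF L] subgroup_add_grp[OF N L NL]])

lemma comm_group_quot: "comm_group (quot L N)"
  unfolding quot_def
  by (rule comm_group.abelian_FactGroup[OF comm_group_add_grp[OF L] subgroup_add_grp[OF N L NL]])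

lemma cls_hom: "cls N \<in> hom (add_grp L) (quot L N)"
proof -
  have "cls N = (\<lambda>v. N #>\<^bsub>add_grp L\<^esub> v)"
    by (auto simp: cls_def r_coset_def add_grp_def)
  then show ?thesis using normal.r_coset_hom_Mod[OF normal_add_grp] by (simp add: quot_def)
qed

lemma mult_quot:
  assumes "x \<in> L" "y \<in> L"
  shows "cls N x \<otimes>\<^bsub>quot L N\<^esub> cls N y = cls N (x + y)"
  using hom_mult[OF cls_hom, of x y] assms by (simp add: add_grp_def)

end

text \<open>Multiplicativity on a quotient is checked on representatives, which keeps cosets out of the
  computations with pairings.\<close>

lemma hom_quot_iff:
  assumes "subgroup L (add_grp UNIV)" "subgroup N (add_grp UNIV)" "N \<subseteq> L"
  shows "f \<in> hom (quot L N) complex_units \<longleftrightarrow>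
    (\<forall>x\<in>L. f (cls N x) \<noteq> 0) \<and> (\<forall>x\<in>L. \<forall>y\<in>L. f (cls N (x + y)) = f (cls N x) * f (cls N y))"
  by (auto simp: hom_def complex_units_def carrier_quot mult_quot[OF assms] Pi_iff)

lemma pairing_quot_iff:
  assumes "subgroup R (add_grp UNIV)" "subgroup L1 (add_grp UNIV)" "subgroup L2 (add_grp UNIV)"
    and "R \<subseteq> L1" "R \<subseteq> L2"
  shows "pairing (quot L1 R) (quot L2 R) g \<longleftrightarrow>
     (\<forall>x\<in>L1. \<forall>y\<in>L2. g (cls R x) (cls R y) \<noteq> 0) \<and>
     (\<forall>x\<in>L1. \<forall>x'\<in>L1. \<forall>y\<in>L2. g (cls R (x + x')) (cls R y) = g (cls R x) (cls R y) * g (cls R x') (cls R y)) \<and>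
     (\<forall>x\<in>L1. \<forall>y\<in>L2. \<forall>y'\<in>L2. g (cls R x) (cls R (y + y')) = g (cls R x) (cls R y) * g (cls R x) (cls R y'))"
  unfolding pairing_def carrier_quot
  by (simp add: hom_quot_iff assms) blast

section \<open>The form of a centralizer transfer map\<close>

text \<open>What the theorem uses of the lattices, with the Lie algebra removed. The set \<open>D\<close> is a domain on
  which the form is additive. The last assumption is the duality between \<open>R\<close> and \<open>L2\<close>: every character of \<open>L2\<close> that kills
  the centralizer of \<open>R\<close> comes from an element of \<open>R\<close>.\<close>

locale transfer_pairing =
  fixes l :: nat and ip :: "'v::ab_group_add \<Rightarrow> 'v \<Rightarrow> complex" and D R L1 L2 :: "'v set"
    and g :: "'v set \<Rightarrow> 'v set \<Rightarrow> complex" and A :: "'v \<Rightarrow> 'v"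
  assumes l_pos: "l > 0"
    and ip_sym: "ip x y = ip y x"
    and ip_add_left: "x \<in> D \<Longrightarrow> y \<in> D \<Longrightarrow> z \<in> D \<Longrightarrow> ip (x + y) z = ip x z + ip y z"
    and R: "subgroup R (add_grp UNIV)"
    and L1: "subgroup L1 (add_grp UNIV)" "R \<subseteq> L1" "L1 \<subseteq> D"
    and L2: "subgroup L2 (add_grp UNIV)" "R \<subseteq> L2" "L2 \<subseteq> D"
    and cent_eq: "cent l ip R L1 = cent l ip R L2"
    and pairing_g: "pairing (quot L1 R) (quot L2 R) g"
    and transfer: "centralizer_transfer l ip R L2 A"
    and duality: "\<And>\<chi>. (\<And>x y. x \<in> L2 \<Longrightarrow> y \<in> L2 \<Longrightarrow> \<chi> (x + y) = \<chi> x * \<chi> y) \<Longrightarrow>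
        (\<And>x. x \<in> cent l ip L2 R \<Longrightarrow> \<chi> x = 1) \<Longrightarrow> \<exists>\<beta>\<in>R. \<forall>x\<in>L2. \<chi> x = qpow l (ip \<beta> x)"
begin

definition g_rep where "g_rep x y = g (cls R x) (cls R y)"

lemma g_rep_nonzero: "x \<in> L1 \<Longrightarrow> y \<in> L2 \<Longrightarrow> g_rep x y \<noteq> 0"
  and g_rep_add_left: "x \<in> L1 \<Longrightarrow> x' \<in> L1 \<Longrightarrow> y \<in> L2 \<Longrightarrow> g_rep (x + x') y = g_rep x y * g_rep x' y"
  and g_rep_add_right: "x \<in> L1 \<Longrightarrow> y \<in> L2 \<Longrightarrow> y' \<in> L2 \<Longrightarrow> g_rep x (y + y') = g_rep x y * g_rep x y'"
  using pairing_g unfolding pairing_quot_iff[OF R L1(1) L2(1) L1(2) L2(2)] g_rep_def by blast+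

lemma g_rep_R_left:
  assumes "x \<in> R" "y \<in> L2"
  shows "g_rep x y = 1"
proof -
  have x: "x \<in> L1" and z: "0 \<in> L1" using assms L1 add_subgroup_zero by auto
  have "g_rep x y = g_rep 0 y" using cls_eq_iff[OF R, of x 0] assms by (simp add: g_rep_def)
  moreover have "g_rep 0 y = g_rep 0 y * g_rep 0 y" using g_rep_add_left[OF z z assms(2)] by simp
  ultimately show ?thesis using g_rep_nonzero[OF x assms(2)] by simp
qed

lemma g_rep_R_right:
  assumes "x \<in> L1" "y \<in> R"
  shows "g_rep x y = 1"
proof -
  have y: "y \<in> L2" and z: "0 \<in> L2" using assms L2 add_subgroup_zero by auto
  have "g_rep x y = g_rep x 0" using cls_eq_iff[OF R, of y 0] assms by (simp add: g_rep_def)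
  moreover have "g_rep x 0 = g_rep x 0 * g_rep x 0" using g_rep_add_right[OF assms(1) z z] by simp
  ultimately show ?thesis using g_rep_nonzero[OF assms(1) y] by simp
qed

lemma ip_add_right: "x \<in> D \<Longrightarrow> y \<in> D \<Longrightarrow> z \<in> D \<Longrightarrow> ip z (x + y) = ip z x + ip z y"
  using ip_add_left[of x y z] by (simp add: ip_sym[of z x] ip_sym[of z y] ip_sym[of z "x + y"])

lemma D_memI: "x \<in> R \<Longrightarrow> x \<in> D" "x \<in> L1 \<Longrightarrow> x \<in> D" "x \<in> L2 \<Longrightarrow> x \<in> D"
  using L1 L2 by auto

lemma A_add: "x \<in> L2 \<Longrightarrow> y \<in> L2 \<Longrightarrow> A (x + y) = A x + A y"
  using transfer unfolding centralizer_transfer_def hom_def by (auto simp: add_grp_def)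

lemma A_image: "A ` L2 = cent l ip L2 R" "A ` R = cent l ip R L2"
  using transfer by (auto simp: centralizer_transfer_def)

lemma A_closed: "x \<in> L2 \<Longrightarrow> A x \<in> L2"
  using A_image(1) by (auto simp: cent_def)

lemma qpow_cent: "x \<in> cent l ip U V \<Longrightarrow> y \<in> V \<Longrightarrow> qpow l (ip x y) = 1 \<and> qpow l (ip y x) = 1"
  using l_pos by (auto simp: cent_def qpow_eq_1_iff ip_sym[of y x])

definition a_rep where "a_rep x y = qpow l (- ip x (A y)) * g_rep x (A y)"

lemma a_rep_add_left: "x \<in> L1 \<Longrightarrow> x' \<in> L1 \<Longrightarrow> y \<in> L2 \<Longrightarrow> a_rep (x + x') y = a_rep x y * a_rep x' y"
  and a_rep_add_right: "x \<in> L1 \<Longrightarrow> y \<in> L2 \<Longrightarrow> y' \<in> L2 \<Longrightarrow> a_rep x (y + y') = a_rep x y * a_rep x y'"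
  and a_rep_nonzero: "x \<in> L1 \<Longrightarrow> y \<in> L2 \<Longrightarrow> a_rep x y \<noteq> 0"
  by (simp_all add: a_rep_def A_add A_closed ip_add_left ip_add_right D_memI g_rep_add_left g_rep_add_right
      g_rep_nonzero qpow_add qpow_diff qpow_minus divide_inverse)

text \<open>Here the transfer property \<open>A L2 = Cent(R)\<close> enters.\<close>

lemma a_rep_R_left: "x \<in> R \<Longrightarrow> y \<in> L2 \<Longrightarrow> a_rep x y = 1"
  using qpow_cent[of "A y" L2 R x] A_image(1) by (auto simp: a_rep_def g_rep_R_left A_closed qpow_minus)

text \<open>Here \<open>A R = Cent(L2)\<close> enters; since the arguments on the left come from \<open>L1\<close>, the equality of the two
  centralizers is needed.\<close>

lemma a_rep_R_right:
  assumes "x \<in> L1" "y \<in> R"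
  shows "a_rep x y = 1"
proof -
  have "A y \<in> cent l ip R L1" using A_image(2) cent_eq assms by blast
  moreover from this have "A y \<in> R" by (simp add: cent_def)
  ultimately show ?thesis
    using qpow_cent[of "A y" R L1 x] assms by (simp add: a_rep_def g_rep_R_right qpow_minus)
qed

lemma a_rep_cong:
  assumes "x \<in> L1" "y \<in> L2" "x' \<in> cls R x" "y' \<in> cls R y"
  shows "a_rep x' y' = a_rep x y"
proof -
  have d: "x' - x \<in> R" "y' - y \<in> R" using assms(3,4) by (simp_all add: mem_cls_iff)
  have y': "y' \<in> L2" using add_subgroup_add[OF L2(1) assms(2), of "y' - y"] d L2(2) by auto
  have "a_rep x' y' = a_rep x y'"
    using a_rep_add_left[OF assms(1), of "x' - x" y'] d(1) y' L1(2) a_rep_R_left[OF d(1) y'] by auto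
  also have "\<dots> = a_rep x y"
    using a_rep_add_right[OF assms(1,2), of "y' - y"] d(2) L2(2) a_rep_R_right[OF assms(1) d(2)] by auto
  finally show ?thesis .
qed

abbreviation a where "a \<equiv> a_form l ip R g A"

lemma a_cls:
  assumes "x \<in> L1" "y \<in> L2"
  shows "a (cls R x) (cls R y) = a_rep x y"
  unfolding a_form_def descend_def
proof (rule the_equality)
  have mem: "z \<in> cls R z" for z using add_subgroup_zero[OF R] by (simp add: mem_cls_iff)
  have rep: "a_form_rep l ip R g A = a_rep" by (simp add: fun_eq_iff a_form_rep_def a_rep_def g_rep_def)
  show "\<forall>\<nu>\<in>cls R x. \<forall>\<mu>\<in>cls R y. a_form_rep l ip R g A \<nu> \<mu> = a_rep x y"
    using a_rep_cong[OF assms] by (simp add: rep)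
  show "z = a_rep x y" if "\<forall>\<nu>\<in>cls R x. \<forall>\<mu>\<in>cls R y. a_form_rep l ip R g A \<nu> \<mu> = z" for z
    using that mem by (auto simp: rep)
qed

lemma pairing_a: "pairing (quot L1 R) (quot L2 R) a"
  unfolding pairing_quot_iff[OF R L1(1) L2(1) L1(2) L2(2)]
  by (simp add: a_cls a_rep_nonzero a_rep_add_left a_rep_add_right add_subgroup_add[OF L1(1)]
      add_subgroup_add[OF L2(1)])

abbreviation C where "C \<equiv> cent_g l ip R g L1 L2"
abbreviation Rad where "Rad \<equiv> radical (quot L1 R) (quot L2 R) a"

lemma C_iff: "x \<in> C \<longleftrightarrow> x \<in> L1 \<and> (\<forall>y\<in>L2. qpow l (ip x y) = g_rep x y)"
  by (simp add: cent_g_def g_rep_def)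

lemma qpow_g_diff_left:
  assumes "x \<in> L1" "x' \<in> L1" "y \<in> L2"
  shows "qpow l (ip (x - x') y) = qpow l (ip x y) / qpow l (ip x' y)"
    and "g_rep (x - x') y = g_rep x y / g_rep x' y"
proof -
  have d: "x - x' \<in> L1" by (rule add_subgroup_diff[OF L1(1) assms(1,2)])
  show "qpow l (ip (x - x') y) = qpow l (ip x y) / qpow l (ip x' y)"
    using ip_add_left[of "x - x'" x' y] assms d by (simp add: D_memI qpow_add)
  show "g_rep (x - x') y = g_rep x y / g_rep x' y"
    using g_rep_add_left[OF d assms(2,3)] g_rep_nonzero[OF assms(2,3)] by simp
qed

lemma C_subgroup: "subgroup C (add_grp UNIV)"
proof (rule add_subgroupI)
  have z: "0 \<in> L1" by (rule add_subgroup_zero[OF L1(1)])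
  show "0 \<in> C"
    using qpow_g_diff_left[OF z z] g_rep_nonzero[OF z] z by (simp add: C_iff)
  show "x - y \<in> C" if "x \<in> C" "y \<in> C" for x y
    using that by (simp add: C_iff qpow_g_diff_left add_subgroup_diff[OF L1(1)])
qed

lemma C_subset: "C \<subseteq> L1" by (auto simp: C_iff)

text \<open>On \<open>R\<close> the pairing \<open>g\<close> is trivial, so the condition that defines \<open>C\<close> becomes integrality of the form.\<close>

lemma C_Int_R: "C \<inter> R = cent l ip R L1"
proof -
  have "x \<in> C \<longleftrightarrow> x \<in> cent l ip R L2" if x: "x \<in> R" for x
    using x L1(2) l_pos by (auto simp: C_iff g_rep_R_left cent_def qpow_eq_1_iff)
  then show ?thesis using cent_eq by (auto simp: cent_def)
qed

text \<open>Surjectivity onto the radical. Being radical says that the character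
  \<open>\<mu> \<mapsto> q^(- (x, \<mu>)) * g x \<mu>\<close> is trivial on the image of \<open>A\<close>, which is the centralizer of \<open>R\<close>; duality gives the
  correction \<open>\<beta>\<close> that makes it trivial on all of \<open>L2\<close>.\<close>

lemma radical_lift:
  assumes x: "x \<in> L1" and rad: "\<And>y. y \<in> L2 \<Longrightarrow> a_rep x y = 1"
  obtains \<beta> where "\<beta> \<in> R" "x + \<beta> \<in> C"
proof -
  define \<chi> where "\<chi> y = qpow l (- ip x y) * g_rep x y" for y
  have "\<exists>\<beta>\<in>R. \<forall>y\<in>L2. \<chi> y = qpow l (ip \<beta> y)"
  proof (rule duality)
    show "\<chi> (y + y') = \<chi> y * \<chi> y'" if "y \<in> L2" "y' \<in> L2" for y y'
      using that x by (simp add: \<chi>_def ip_add_right D_memI g_rep_add_right qpow_diff qpow_minus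
          divide_inverse)
    show "\<chi> y = 1" if "y \<in> cent l ip L2 R" for y
      using that rad unfolding A_image(1)[symmetric] by (auto simp: \<chi>_def a_rep_def)
  qed
  then obtain \<beta> where \<beta>: "\<beta> \<in> R" "\<And>y. y \<in> L2 \<Longrightarrow> \<chi> y = qpow l (ip \<beta> y)" by blast
  have \<beta>L: "\<beta> \<in> L1" using \<beta>(1) L1(2) by blast
  have "qpow l (ip (x + \<beta>) y) = g_rep (x + \<beta>) y" if y: "y \<in> L2" for y
  proof -
    have "qpow l (ip (x + \<beta>) y) = qpow l (ip x y) * \<chi> y"
      using x \<beta>L y by (simp add: ip_add_left D_memI qpow_add \<beta>(2))
    also have "\<dots> = g_rep x y" by (simp add: \<chi>_def qpow_minus)
    also have "\<dots> = g_rep (x + \<beta>) y" using x \<beta>L y \<beta>(1) by (simp add: g_rep_add_left g_rep_R_left)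
    finally show ?thesis .
  qed
  then have "x + \<beta> \<in> C" using add_subgroup_add[OF L1(1) x \<beta>L] by (simp add: C_iff)
  then show ?thesis using \<beta>(1) that by blast
qed

lemma Rad_eq: "Rad = cls R ` C"
proof
  show "cls R ` C \<subseteq> Rad"
  proof
    fix X assume "X \<in> cls R ` C"
    then obtain x where x: "x \<in> C" "X = cls R x" by blast
    have xL: "x \<in> L1" using x C_subset by blast
    have "a_rep x y = 1" if "y \<in> L2" for y
    proof -
      have "qpow l (ip x (A y)) = g_rep x (A y)" using x A_closed[OF that] by (simp add: C_iff)
      then show ?thesis using g_rep_nonzero[OF xL A_closed[OF that]] by (simp add: a_rep_def qpow_minus)
    qed
    then show "X \<in> Rad" using xL x(2) by (auto simp: radical_def carrier_quot a_cls)
  qed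
next
  show "Rad \<subseteq> cls R ` C"
  proof
    fix X assume "X \<in> Rad"
    then obtain x where x: "x \<in> L1" "X = cls R x" "\<And>y. y \<in> L2 \<Longrightarrow> a_rep x y = 1"
      by (auto simp: radical_def carrier_quot a_cls)
    obtain \<beta> where \<beta>: "\<beta> \<in> R" "x + \<beta> \<in> C" using radical_lift[OF x(1,3)] by blast
    have "cls R (x + \<beta>) = cls R x" using \<beta>(1) by (simp add: cls_eq_iff[OF R])
    then show "X \<in> cls R ` C" using \<beta>(2) x(2) by (metis imageI)
  qed
qed

lemma group_hom_cls: "group_hom (add_grp L1) (quot L1 R) (cls R)"
  using cls_hom[OF L1(1) R L1(2)] comm_group_add_grp[OF L1(1)] comm_group_quot[OF L1(1) R L1(2)]
  by (simp add: group_hom_def group_hom_axioms_def comm_group_def)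

lemma Rad_subgroup: "subgroup Rad (quot L1 R)"
  unfolding Rad_eq
  by (rule group_hom.subgroup_img_is_subgroup[OF group_hom_cls
        subgroup_add_grp[OF C_subgroup L1(1) C_subset]])

lemma cent_normal: "cent l ip R L1 \<lhd> add_grp C"
proof -
  have "subgroup (C \<inter> R) (add_grp UNIV)"
    using add_subgroup_zero[OF R] add_subgroup_zero[OF C_subgroup]
    by (intro add_subgroupI) (auto intro: add_subgroup_diff[OF R] add_subgroup_diff[OF C_subgroup])
  then have "C \<inter> R \<lhd> add_grp C" by (rule normal_add_grp[OF C_subgroup _ Int_lower1])
  then show ?thesis by (simp only: C_Int_R)
qed

text \<open>The first isomorphism theorem for the projection of \<open>C\<close> to the classes of \<open>R\<close>, whose kernel is
  \<open>C \<inter> R\<close> and whose image is the radical.\<close>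

lemma ex_iso:
  "\<exists>\<phi> \<in> iso (quot C (cent l ip R L1)) ((quot L1 R)\<lparr>carrier := Rad\<rparr>).
     \<forall>\<nu>\<in>C. \<phi> (cls (cent l ip R L1) \<nu>) = cls R \<nu>"
proof -
  let ?Q = "(quot L1 R)\<lparr>carrier := Rad\<rparr>"
  let ?\<phi> = "\<lambda>X. the_elem (cls R ` X)"
  have Q: "group (quot L1 R)" using comm_group_quot[OF L1(1) R L1(2)] by (simp add: comm_group_def)
  have "cls R \<in> hom (add_grp C) ?Q"
    using C_subset
    by (intro homI) (auto simp: mult_quot[OF L1(1) R L1(2)] Rad_eq add_grp_def subset_iff)
  then have "group_hom (add_grp C) ?Q (cls R)"
    using comm_group_add_grp[OF C_subgroup] group.subgroup_imp_group[OF Q Rad_subgroup]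
    by (simp add: group_hom_def group_hom_axioms_def comm_group_def)
  then interpret h: group_hom "add_grp C" ?Q "cls R" .
  have ker: "kernel (add_grp C) ?Q (cls R) = cent l ip R L1"
    using cls_eq_iff[OF R, of _ 0]
    by (auto simp: kernel_def C_Int_R[symmetric] one_quot add_grp_def cls_zero)
  have "cls R ` carrier (add_grp C) = carrier ?Q" by (simp add: Rad_eq add_grp_def)
  then have "?\<phi> \<in> iso (add_grp C Mod kernel (add_grp C) ?Q (cls R)) ?Q"
    by (rule h.FactGroup_iso_set)
  then have "?\<phi> \<in> iso (quot C (cent l ip R L1)) ?Q"
    by (simp only: ker quot_def[symmetric])
  moreover have "?\<phi> (cls (cent l ip R L1) \<nu>) = cls R \<nu>" if "\<nu> \<in> C" for \<nu>
  proof -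
    have "cls R (k + \<nu>) = cls R \<nu>" if "k \<in> cent l ip R L1" for k
      using that by (simp add: cls_eq_iff[OF R] cent_def)
    moreover have "0 \<in> cent l ip R L1"
      using add_subgroup_zero[OF C_subgroup] add_subgroup_zero[OF R] by (simp add: C_Int_R[symmetric])
    ultimately have "cls R ` cls (cent l ip R L1) \<nu> = {cls R \<nu>}"
      unfolding cls_alt[of "cent l ip R L1"] image_image by (auto intro!: image_eqI[of _ _ 0])
    then show ?thesis by simp
  qed
  ultimately show ?thesis by (intro bexI[of _ ?\<phi>] ballI)
qed

end

section \<open>Integral spans and denominators\<close>

lemma common_denominator:
  fixes X :: "'a::field_char_0 set"
  assumes "finite X" "X \<subseteq> \<rat>"
  shows "\<exists>s::nat. s > 0 \<and> (\<forall>x\<in>X. of_nat s * x \<in> \<int>)"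
  using assms
proof (induction X rule: finite_induct)
  case empty
  then show ?case by (intro exI[of _ 1]) simp
next
  case (insert x X)
  then obtain s where s: "s > 0" "\<forall>x\<in>X. of_nat s * x \<in> \<int>" by auto
  obtain p q where pq: "q > 0" "x = of_int p / of_int q"
    using insert.prems by (metis Rats_cases' insert_subset)
  have "of_nat (s * nat q) * x = of_int (int s * p)" using pq by simp
  then have "of_nat (s * nat q) * x \<in> \<int>" by (metis Ints_of_int)
  moreover have "of_nat (s * nat q) * y \<in> \<int>" if "y \<in> X" for y
  proof -
    have "of_nat (s * nat q) * y = of_nat (nat q) * (of_nat s * y)" by simp
    then show ?thesis using s(2) that by (metis Ints_mult Ints_of_nat)
  qed
  moreover have "s * nat q > 0" using s(1) pq(1) by simp
  ultimately show ?case by (metis insert_iff)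
qed

lemma int_span_subgroup: "subgroup (int_span n v) (add_grp UNIV)"
proof (rule add_subgroupI)
  show "0 \<in> int_span n v"
    unfolding int_span_def by (rule range_eqI[of _ _ "\<lambda>_. 0"]) (simp add: fun_eq_iff)
next
  fix x y assume "x \<in> int_span n v" "y \<in> int_span n v"
  then obtain j k :: "nat \<Rightarrow> int" where
    "x = (\<lambda>z. \<Sum>i = 1..n. of_int (j i) * v i z)" "y = (\<lambda>z. \<Sum>i = 1..n. of_int (k i) * v i z)"
    by (auto simp: int_span_def)
  then have "x - y = (\<lambda>z. \<Sum>i = 1..n. of_int (j i - k i) * v i z)"
    by (simp add: fun_eq_iff left_diff_distrib sum_subtractf)
  then show "x - y \<in> int_span n v"
    unfolding int_span_def by (intro range_eqI[of _ _ "\<lambda>i. j i - k i"])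
qed

section \<open>Joint eigenvectors and the root space decomposition\<close>

text \<open>Joint eigenvectors with distinct joint eigenvalues are independent. Applying \<open>T i - p0 i\<close> to a
  relation removes the term of \<open>p0\<close> and multiplies each other term by \<open>p i - p0 i\<close>, which is nonzero for
  a suitable \<open>i\<close>.\<close>

lemma (in vector_space) sum_joint_eigenvectors_eq_0:
  fixes T :: "'i \<Rightarrow> 'b \<Rightarrow> 'b" and F :: "('i \<Rightarrow> 'a) set" and v :: "('i \<Rightarrow> 'a) \<Rightarrow> 'b"
  assumes "finite F"
    and lin: "\<And>i. i \<in> I \<Longrightarrow> Vector_Spaces.linear scale scale (T i)"
    and "\<And>p q. p \<in> F \<Longrightarrow> q \<in> F \<Longrightarrow> p \<noteq> q \<Longrightarrow> \<exists>i\<in>I. p i \<noteq> q i"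
    and "\<And>p i. p \<in> F \<Longrightarrow> i \<in> I \<Longrightarrow> T i (v p) = p i *s v p"
    and "(\<Sum>p\<in>F. v p) = 0"
    and "p \<in> F"
  shows "v p = 0"
  using assms(1,3-)
proof (induction F arbitrary: v p rule: finite_induct)
  case empty
  then show ?case by simp
next
  case (insert p0 F)
  have zero: "v p = 0" if p: "p \<in> F" for p
  proof -
    have *: "(p i - p0 i) *s v p = 0" if i: "i \<in> I" for i
    proof (rule insert.IH[where v = "\<lambda>p. (p i - p0 i) *s v p"])
      interpret Ti: Vector_Spaces.linear scale scale "T i" by (rule lin[OF i])
      have "0 = T i (\<Sum>p\<in>insert p0 F. v p) - p0 i *s (\<Sum>p\<in>insert p0 F. v p)"
        unfolding insert.prems(3) by (simp add: Ti.zero)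
      also have "\<dots> = (\<Sum>p\<in>insert p0 F. T i (v p) - p0 i *s v p)"
        by (simp only: Ti.sum scale_sum_right sum_subtractf)
      also have "\<dots> = (\<Sum>p\<in>insert p0 F. (p i - p0 i) *s v p)"
        by (rule sum.cong) (simp_all add: insert.prems(2)[OF _ i] scale_left_diff_distrib)
      also have "\<dots> = (\<Sum>p\<in>F. (p i - p0 i) *s v p)"
        using insert.hyps by simp
      finally show "(\<Sum>p\<in>F. (p i - p0 i) *s v p) = 0" by simp
      show "T j ((p i - p0 i) *s v p) = p j *s (p i - p0 i) *s v p" if "p \<in> F" "j \<in> I" for p j
      proof -
        interpret Tj: Vector_Spaces.linear scale scale "T j" by (rule lin[OF that(2)])
        show ?thesis using that by (simp add: Tj.scale insert.prems(2) mult.commute)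
      qed
    qed (use insert.prems p in auto)
    moreover have "p \<noteq> p0" using p insert.hyps by blast
    ultimately show ?thesis
      using insert.prems(1)[of p p0] p by (metis insertCI eq_iff_diff_eq_0 scale_eq_0_iff)
  qed
  then have "v p0 = 0" using insert.prems(3) insert.hyps by simp
  with zero show ?case using insert.prems(4) by blast
qed

text \<open>Choosing one joint eigenvector for each joint eigenvalue gives an independent set.\<close>

lemma (in finite_dimensional_vector_space) finite_joint_eigenvalues:
  fixes T :: "'i \<Rightarrow> 'b \<Rightarrow> 'b" and F :: "('i \<Rightarrow> 'a) set"
  assumes lin: "\<And>i. i \<in> I \<Longrightarrow> Vector_Spaces.linear scale scale (T i)"
    and dist: "\<And>p q. p \<in> F \<Longrightarrow> q \<in> F \<Longrightarrow> p \<noteq> q \<Longrightarrow> \<exists>i\<in>I. p i \<noteq> q i"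
    and ex: "\<And>p. p \<in> F \<Longrightarrow> \<exists>x. x \<noteq> 0 \<and> (\<forall>i\<in>I. T i x = p i *s x)"
  shows "finite F"
proof -
  obtain v where v: "\<And>p. p \<in> F \<Longrightarrow> v p \<noteq> 0" "\<And>p i. p \<in> F \<Longrightarrow> i \<in> I \<Longrightarrow> T i (v p) = p i *s v p"
    using ex by metis
  have inj: "inj_on v F"
  proof (rule inj_onI)
    fix p q assume pq: "p \<in> F" "q \<in> F" "v p = v q"
    then have "p i *s v p = q i *s v p" if "i \<in> I" for i
      using v(2) that by metis
    then have "\<forall>i\<in>I. p i = q i" using v(1)[OF pq(1)] by simp
    then show "p = q" using dist pq by blast
  qed
  have "independent (v ` F)"
    unfolding independent_explicit_module
  proof (intro allI impI)
    fix t u w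
    assume t: "finite t" "t \<subseteq> v ` F" "(\<Sum>w\<in>t. u w *s w) = 0" "w \<in> t"
    define F' where "F' = {p \<in> F. v p \<in> t}"
    have t_eq: "t = v ` F'" using t(2) by (auto simp: F'_def)
    have inj': "inj_on v F'" using inj by (auto simp: F'_def inj_on_def)
    have fin: "finite F'" using t(1) inj' by (simp add: t_eq finite_image_iff)
    obtain p where p: "p \<in> F'" "w = v p" using t(4) t_eq by blast
    have "u (v p) *s v p = 0"
    proof (rule sum_joint_eigenvectors_eq_0[where I = I and T = T and F = F'
             and v = "\<lambda>p. u (v p) *s v p"])
      show "(\<Sum>p\<in>F'. u (v p) *s v p) = 0"
        using t(3) by (simp add: t_eq sum.reindex[OF inj'])
      show "T i (u (v p) *s v p) = p i *s u (v p) *s v p" if "p \<in> F'" "i \<in> I" for p i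
      proof -
        interpret Ti: Vector_Spaces.linear scale scale "T i" by (rule lin[OF that(2)])
        show ?thesis using that v(2)[of p i] by (simp add: Ti.scale F'_def mult.commute)
      qed
    qed (use lin dist fin p in \<open>auto simp: F'_def\<close>)
    then show "u w = 0" using v(1) p by (auto simp: F'_def)
  qed
  then have "finite (v ` F)" by (rule finiteI_independent)
  then show ?thesis using inj by (simp add: finite_image_iff)
qed

locale cartan_data =
  fixes scale :: "complex \<Rightarrow> 'g::ab_group_add \<Rightarrow> 'g" (infixr \<open>*s\<close> 75)
    and br :: "'g \<Rightarrow> 'g \<Rightarrow> 'g" and H :: "'g set" and B :: "'g \<Rightarrow> 'g \<Rightarrow> complex"
  assumes simple: "simple_lie_algebra scale br"
    and fin_dim: "finite_dim scale"
    and cartan: "cartan_subalgebra scale br H"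
    and form: "invariant_form scale br B"
begin

sublocale vector_space scale
  using simple by (simp add: simple_lie_algebra_def lie_algebra_def)

abbreviation \<Phi> where "\<Phi> \<equiv> roots scale br H"
abbreviation D where "D \<equiv> dual_space scale H"

lemma linear_br: "Vector_Spaces.linear scale scale (br x)"
  and linear_br_left: "Vector_Spaces.linear scale scale (\<lambda>x. br x y)"
  and br_self: "br x x = 0"
  and jacobi: "br x (br y z) + br y (br z x) + br z (br x y) = 0"
  using simple by (auto simp: simple_lie_algebra_def lie_algebra_def)

lemma br_add: "br x (y + z) = br x y + br x z"
  and br_scale: "br x (c *s y) = c *s br x y"
  and br_zero: "br x 0 = 0"
  and br_minus: "br x (- y) = - br x y"
  and br_diff: "br x (y - z) = br x y - br x z"
proof -
  interpret Vector_Spaces.linear scale scale "br x" by (rule linear_br)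
  show "br x (y + z) = br x y + br x z" "br x (c *s y) = c *s br x y" "br x 0 = 0"
     "br x (- y) = - br x y"  "br x (y - z) = br x y - br x z"
    by (simp_all add: add scale neg diff)
qed

lemma br_add_left: "br (x + y) z = br x z + br y z"
  and br_scale_left: "br (c *s x) z = c *s br x z"
  and br_zero_left: "br 0 z = 0"
proof -
  interpret Vector_Spaces.linear scale scale "\<lambda>x. br x z" by (rule linear_br_left)
  show "br (x + y) z = br x z + br y z" "br (c *s x) z = c *s br x z" "br 0 z = 0"
    by (simp_all add: add scale zero)
qed

lemma br_sum: "br x (\<Sum>i\<in>S. f i) = (\<Sum>i\<in>S. br x (f i))"
proof -
  interpret Vector_Spaces.linear scale scale "br x" by (rule linear_br)
  show ?thesis by (rule sum)
qed

lemma br_swap: "br y x = - br x y"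
proof -
  have "0 = br (x + y) (x + y)" by (simp add: br_self)
  also have "\<dots> = (br x x + br y x) + (br x y + br y y)" by (simp only: br_add br_add_left)
  also have "\<dots> = br x y + br y x" by (simp add: br_self)
  finally show ?thesis by (metis minus_unique)
qed

lemma br_derivation: "br x (br y z) = br (br x y) z + br y (br x z)"
  using jacobi[of x y z] by (simp add: br_swap[of z] br_minus algebra_simps)

lemma linear_B: "Vector_Spaces.linear scale (*) (B x)"
  and B_sym: "B x y = B y x"
  and B_invariant: "B (br x y) z = B x (br y z)"
  and B_nondegenerate: "(\<And>y. B x y = 0) \<Longrightarrow> x = 0"
  using form by (auto simp: invariant_form_def)

lemma B_add: "B x (y + z) = B x y + B x z"
  and B_scale: "B x (c *s y) = c * B x y"
  and B_zero: "B x 0 = 0"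
  and B_minus: "B x (- y) = - B x y"
  and B_diff: "B x (y - z) = B x y - B x z"
proof -
  interpret Vector_Spaces.linear scale "(*)" "B x" by (rule linear_B)
  show "B x (y + z) = B x y + B x z" "B x (c *s y) = c * B x y" "B x 0 = 0"
     "B x (- y) = - B x y"  "B x (y - z) = B x y - B x z"
    by (simp_all add: add scale neg diff)
qed

lemma B_add_left: "B (x + y) z = B x z + B y z"
  and B_scale_left: "B (c *s x) z = c * B x z"
  and B_diff_left: "B (x - y) z = B x z - B y z"
  by (simp_all add: B_sym[of _ z] B_add B_scale B_diff)

lemma subspace_H: "subspace H"
  and br_H: "h \<in> H \<Longrightarrow> h' \<in> H \<Longrightarrow> br h h' = 0"
  and H_maximal: "(\<And>h. h \<in> H \<Longrightarrow> br h x = 0) \<Longrightarrow> x \<in> H"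
  and H_diagonalizable: "h \<in> H \<Longrightarrow> span {v. \<exists>c. br h v = c *s v} = UNIV"
  using cartan by (auto simp: cartan_subalgebra_def)

lemma obtains_finite_basis:
  obtains Basis where "finite_dimensional_vector_space scale Basis"
proof -
  obtain S where S: "finite S" "span S = UNIV" using fin_dim by (auto simp: finite_dim_def)
  obtain Bs where "Bs \<subseteq> S" "independent Bs" "S \<subseteq> span Bs"
    using maximal_independent_subset by blast
  then have "finite_dimensional_vector_space scale Bs"
    using S vector_space_axioms
    by (auto simp: finite_dimensional_vector_space_def finite_dimensional_vector_space_axioms_def
        intro: finite_subset dest: span_mono) (metis UNIV_I span_minimal subsetD subspace_span)
  then show ?thesis by (rule that)
qed

definition weight_space :: "('g \<Rightarrow> complex) \<Rightarrow> 'g set" where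
  "weight_space \<gamma> = {v. \<forall>h\<in>H. br h v = \<gamma> h *s v}"

lemma weight_spaceD: "v \<in> weight_space \<gamma> \<Longrightarrow> h \<in> H \<Longrightarrow> br h v = \<gamma> h *s v"
  by (simp add: weight_space_def)

lemma subspace_weight_space: "subspace (weight_space \<gamma>)"
  by (auto simp: subspace_def weight_space_def br_add br_scale br_zero scale_right_distrib
      mult.commute)

text \<open>A Cartan subalgebra is its own centralizer.\<close>

lemma weight_space_0: "weight_space 0 = H"
  using br_H H_maximal by (auto simp: weight_space_def)

lemma dual_ext:
  assumes "f \<in> D" "f' \<in> D" "\<And>h. h \<in> H \<Longrightarrow> f h = f' h"
  shows "f = f'"
proof
  show "f h = f' h" for h
    using assms by (cases "h \<in> H") (auto simp: dual_space_def)
qed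

lemma D_add: "f \<in> D \<Longrightarrow> f' \<in> D \<Longrightarrow> f + f' \<in> D"
  and D_minus: "f \<in> D \<Longrightarrow> - f \<in> D"
  and D_zero: "0 \<in> D"
  and D_scale: "f \<in> D \<Longrightarrow> (\<lambda>h. c * f h) \<in> D"
  by (auto simp: dual_space_def algebra_simps)

lemma roots_iff: "\<gamma> \<in> \<Phi> \<longleftrightarrow> \<gamma> \<in> D \<and> \<gamma> \<noteq> 0 \<and> (\<exists>x. x \<noteq> 0 \<and> x \<in> weight_space \<gamma>)"
  by (auto simp: roots_def weight_space_def)

lemma D_nonzero:
  assumes "f \<in> D" "f \<noteq> 0"
  obtains h where "h \<in> H" "f h \<noteq> 0"
  using dual_ext[OF assms(1) D_zero] assms(2) by auto

text \<open>Used twice: the set of roots is finite, and so is every string of weights.\<close>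

lemma finite_weights:
  assumes "F \<subseteq> D" "\<And>\<gamma>. \<gamma> \<in> F \<Longrightarrow> \<exists>x. x \<noteq> 0 \<and> x \<in> weight_space \<gamma>"
  shows "finite F"
proof -
  obtain Basis where "finite_dimensional_vector_space scale Basis" by (rule obtains_finite_basis)
  then interpret finite_dimensional_vector_space scale Basis .
  show ?thesis
  proof (rule finite_joint_eigenvalues[where I = H and T = br])
    show "\<exists>h\<in>H. p h \<noteq> q h" if "p \<in> F" "q \<in> F" "p \<noteq> q" for p q
      using dual_ext that assms(1) by blast
  qed (use assms(2) in \<open>auto simp: linear_br weight_space_def\<close>)
qed

text \<open>Simultaneous diagonalization of commuting diagonalizable operators, one at a time.\<close>

lemma span_joint_eigenvectors:
  assumes "finite S" "S \<subseteq> H"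
  shows "span {v. \<forall>h\<in>S. \<exists>c. br h v = c *s v} = UNIV"
  using assms
proof (induction S rule: finite_induct)
  case empty
  then show ?case by simp
next
  case (insert k S)
  let ?E = "{v. \<forall>h\<in>insert k S. \<exists>c. br h v = c *s v}"
  have k: "k \<in> H" using insert.prems by simp
  have "v \<in> span ?E" if v: "\<forall>h\<in>S. \<exists>c. br h v = c *s v" for v
  proof -
    obtain t r where t: "finite t" "t \<subseteq> {v. \<exists>c. br k v = c *s v}" "v = (\<Sum>a\<in>t. r a *s a)"
    proof -
      have "v \<in> span {v. \<exists>c. br k v = c *s v}" using H_diagonalizable[OF k] by simp
      then show ?thesis unfolding span_explicit using that by blast
    qed
    have "\<forall>a\<in>t. \<exists>c. br k a = c *s a" using t(2) by blast
    from bchoice[OF this] obtain e where e: "\<And>a. a \<in> t \<Longrightarrow> br k a = e a *s a" by blast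
    define w where "w c = (\<Sum>a | a \<in> t \<and> e a = c. r a *s a)" for c
    \<comment> \<open>The components of \<open>v\<close> in the eigenspaces of \<open>k\<close>; they turn out to be joint eigenvectors for \<open>S\<close> as well.\<close>
    have v_eq: "v = (\<Sum>c\<in>e ` t. w c)"
      unfolding w_def t(3) by (rule sum.image_gen[OF t(1)])
    have kw: "br k (w c) = c *s w c" for c
      unfolding w_def br_sum scale_sum_right
      by (rule sum.cong) (auto simp: br_scale e mult.commute)
    have "w c \<in> ?E" if c: "c \<in> e ` t" for c
    proof -
      have "\<exists>d. br h (w c) = d *s w c" if h: "h \<in> S" for h
      proof -
        obtain d where d: "br h v = d *s v" using v h by blast
        have hH: "h \<in> H" using h insert.prems by auto
        \<comment> \<open>The defects \<open>u c\<close> lie in distinct eigenspaces of \<open>k\<close> and add up to \<open>0\<close>.\<close>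
        define u where "u c = br h (w c) - d *s w c" for c
        have ku: "br k (u c) = c *s u c" for c
          using br_derivation[of k h "w c"] br_H[OF k hH] 
          by (simp add: u_def br_diff br_scale kw br_zero_left scale_right_diff_distrib
              mult.commute)
        have su: "(\<Sum>c\<in>e ` t. u c) = 0"
          using d by (simp add: u_def sum_subtractf v_eq br_sum scale_sum_right)
        have inj: "inj_on (\<lambda>c (_::unit). c) (e ` t)" by (auto simp: inj_on_def fun_eq_iff)
        have "u ((\<lambda>_::unit. c) ()) = 0"
        proof (rule sum_joint_eigenvectors_eq_0[where I = "UNIV" and T = "\<lambda>_. br k"
              and F = "(\<lambda>c (_::unit). c) ` (e ` t)" and v = "\<lambda>p. u (p ())"])
          show "(\<Sum>p\<in>(\<lambda>c (_::unit). c) ` e ` t. u (p ())) = 0"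
            using su unfolding sum.reindex[OF inj] by simp
        qed (use t(1) c ku in \<open>auto simp: linear_br fun_eq_iff\<close>)
        then show ?thesis by (auto simp: u_def)
      qed
      then show ?thesis using kw by auto
    qed
    then show ?thesis unfolding v_eq by (intro span_sum) (auto intro: span_base)
  qed
  then have "span {v. \<forall>h\<in>S. \<exists>c. br h v = c *s v} \<subseteq> span ?E"
    by (intro span_minimal) auto
  then show ?case using insert by auto
qed

text \<open>The eigenvalues of a joint eigenvector of a basis of \<open>H\<close> form a functional on \<open>H\<close>, which is zero or a
  root. The zero weight space is \<open>H\<close>, so this is the decomposition into \<open>H\<close> and the root spaces.\<close>

lemma root_space_decomposition: "span (\<Union>\<gamma>\<in>insert 0 \<Phi>. weight_space \<gamma>) = UNIV"
proof -
  obtain Basis where "finite_dimensional_vector_space scale Basis" by (rule obtains_finite_basis)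
  then interpret finite_dimensional_vector_space scale Basis .
  obtain S where S: "S \<subseteq> H" "independent S" "H \<subseteq> span S"
    using maximal_independent_subset by blast
  have "v \<in> span (\<Union>\<gamma>\<in>insert 0 \<Phi>. weight_space \<gamma>)" if v: "\<forall>h\<in>S. \<exists>c. br h v = c *s v" for v
  proof (cases "v = 0")
    case True
    then show ?thesis by (simp add: span_zero)
  next
    case False
    have "\<exists>d. br (x + y) v = d *s v" if "br x v = a *s v" "br y v = b *s v" for x y a b
      using that by (intro exI[of _ "a + b"]) (simp add: br_add_left scale_left_distrib)
    then have "subspace {h. \<exists>c. br h v = c *s v}"
      by (intro subspaceI) (auto simp: br_zero_left br_scale_left intro: exI[of _ 0])
    then have "\<forall>h\<in>H. \<exists>c. br h v = c *s v"
      using S(3) v span_minimal[of S "{h. \<exists>c. br h v = c *s v}"] by blast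
    then obtain c where c: "\<And>h. h \<in> H \<Longrightarrow> br h v = c h *s v" by metis
    define \<gamma> where "\<gamma> h = (if h \<in> H then c h else 0)" for h
    have "\<gamma> \<in> D"
    proof -
      have "c (x + y) *s v = (c x + c y) *s v" if "x \<in> H" "y \<in> H" for x y
        using that c subspace_add[OF subspace_H] by (metis br_add_left scale_left_distrib)
      moreover have "c (a *s x) *s v = (a * c x) *s v" if "x \<in> H" for x a
        using that c subspace_scale[OF subspace_H] by (metis br_scale_left scale_scale)
      ultimately show ?thesis
        using False by (auto simp: dual_space_def \<gamma>_def subspace_add[OF subspace_H]
            subspace_scale[OF subspace_H])
    qed
    moreover have "v \<in> weight_space \<gamma>" by (simp add: weight_space_def \<gamma>_def c)
    ultimately have "\<gamma> \<in> insert 0 \<Phi>" using False by (auto simp: roots_iff)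
    then show ?thesis using \<open>v \<in> weight_space \<gamma>\<close> by (intro span_base) blast
  qed
  then have "span {v. \<forall>h\<in>S. \<exists>c. br h v = c *s v} \<subseteq> span (\<Union>\<gamma>\<in>insert 0 \<Phi>. weight_space \<gamma>)"
    by (intro span_minimal) auto
  then show ?thesis using span_joint_eigenvectors[of S] S finiteI_independent by auto
qed

section \<open>The form on the dual of the Cartan subalgebra\<close>

text \<open>Invariance moves \<open>h\<close> from one argument to the other at the cost of a sign.\<close>

lemma B_weight_spaces_orthogonal:
  assumes "x \<in> weight_space \<beta>" "y \<in> weight_space \<gamma>" "h \<in> H" "\<beta> h + \<gamma> h \<noteq> 0"
  shows "B x y = 0"
proof -
  have "- (\<beta> h * B x y) = B (br x h) y"
    using assms by (simp add: br_swap[of x h] weight_spaceD B_sym[of _ y] B_minus B_scale)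
  also have "\<dots> = \<gamma> h * B x y"
    using assms by (simp add: B_invariant weight_spaceD B_scale)
  finally have eq: "- (\<beta> h * B x y) = \<gamma> h * B x y" .
  have "(\<beta> h + \<gamma> h) * B x y = 0" by (simp add: distrib_right eq[symmetric])
  then show ?thesis using assms(4) by simp
qed

text \<open>A vector of \<open>H\<close> is orthogonal to every root space, so orthogonality to \<open>H\<close> makes it orthogonal to
  everything.\<close>

lemma B_nondegenerate_on_H:
  assumes t: "t \<in> H" and "\<And>h. h \<in> H \<Longrightarrow> B t h = 0"
  shows "t = 0"
proof -
  have "subspace {x. B t x = 0}" by (auto simp: subspace_def B_add B_scale B_zero)
  moreover have "B t x = 0" if "\<gamma> \<in> insert 0 \<Phi>" "x \<in> weight_space \<gamma>" for x \<gamma>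
  proof (cases "\<gamma> = 0")
    case True
    then show ?thesis using that assms(2) by (simp add: weight_space_0)
  next
    case False
    then have "\<gamma> \<in> D" using that by (auto simp: roots_iff)
    then obtain h where "h \<in> H" "\<gamma> h \<noteq> 0" using D_nonzero False by blast
    then show ?thesis
      using B_weight_spaces_orthogonal[of t 0 x \<gamma> h] t that(2) by (simp add: weight_space_0)
  qed
  ultimately have "span (\<Union>\<gamma>\<in>insert 0 \<Phi>. weight_space \<gamma>) \<subseteq> {x. B t x = 0}"
    by (intro span_minimal) auto
  then show ?thesis unfolding root_space_decomposition by (intro B_nondegenerate) auto
qed

text \<open>Nondegeneracy on \<open>H\<close> gives uniqueness, and existence follows by counting dimensions. This makes the
  definite description in \<open>dual_form\<close> meaningful.\<close>

lemma dual_represented: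
  assumes f: "f \<in> D"
  shows "\<exists>!t. t \<in> H \<and> (\<forall>h\<in>H. B t h = f h)"
proof (rule ex_ex1I)
  fix t t' assume "t \<in> H \<and> (\<forall>h\<in>H. B t h = f h)" "t' \<in> H \<and> (\<forall>h\<in>H. B t' h = f h)"
  then have "t - t' = 0"
    by (intro B_nondegenerate_on_H) (auto simp: subspace_diff[OF subspace_H] B_diff_left)
  then show "t = t'" by simp
next
  obtain Basis where "finite_dimensional_vector_space scale Basis" by (rule obtains_finite_basis)
  then interpret finite_dimensional_vector_space scale Basis .
  obtain S where S: "S \<subseteq> H" "independent S" "H \<subseteq> span S"
    using maximal_independent_subset by blast
  have fin: "finite S" using S(2) by (rule finiteI_independent)
  have H_eq: "H = span S" using S span_minimal[OF S(1) subspace_H] by blast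
  \<comment> \<open>This endomorphism of \<open>H\<close> stores the values of \<open>B x\<close> on the basis; being injective on \<open>H\<close>, it is onto.\<close>
  define T where "T x = (\<Sum>b\<in>S. B x b *s b)" for x
  have T: "Vector_Spaces.linear scale scale T"
    by unfold_locales (auto simp: T_def vector_space_axioms B_add_left B_scale_left scale_left_distrib
        sum.distrib scale_sum_right)
  have eqI: "B x h = B y h" if "T x = T y" "h \<in> H" for x y h
  proof -
    have "(\<Sum>b\<in>S. (B x b - B y b) *s b) = 0"
      using that(1) by (simp add: T_def scale_left_diff_distrib sum_subtractf)
    then have "B x b - B y b = 0" if "b \<in> S" for b
      using independentD[OF S(2) fin subset_refl, of "\<lambda>b. B x b - B y b" b] that by simp
    then have "S \<subseteq> {h. B x h = B y h}" by auto
    moreover have "subspace {h. B x h = B y h}" by (auto simp: subspace_def B_add B_scale B_zero)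
    ultimately show ?thesis using span_minimal that(2) H_eq by blast
  qed
  have inj: "inj_on T H"
  proof (rule inj_onI)
    fix x y assume "x \<in> H" "y \<in> H" "T x = T y"
    then have "x - y = 0"
      by (intro B_nondegenerate_on_H) (auto simp: subspace_diff[OF subspace_H] B_diff_left intro: eqI)
    then show "x = y" by simp
  qed
  have "T ` H \<subseteq> H"
    using S(1) by (auto simp: T_def intro!: subspace_sum[OF subspace_H] subspace_scale[OF subspace_H])
  interpret T: Vector_Spaces.linear scale scale T by (rule T)
  interpret P: finite_dimensional_vector_space_pair_1 scale Basis scale
    by unfold_locales
  have "dim (T ` H) = dim H"
    by (rule P.dim_image_eq[OF T]) (use inj subspace_H in \<open>simp add: span_eq_iff[THEN iffD2]\<close>)
  then have "T ` H = H"
    using \<open>T ` H \<subseteq> H\<close> T.subspace_image[OF subspace_H] subspace_H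
    by (intro subspace_dim_equal) auto
  moreover have "(\<Sum>b\<in>S. f b *s b) \<in> H"
    using S(1) by (intro subspace_sum[OF subspace_H] subspace_scale[OF subspace_H]) auto
  ultimately obtain t where t: "t \<in> H" "T t = (\<Sum>b\<in>S. f b *s b)" by (metis imageE)
  have "(\<Sum>b\<in>S. (B t b - f b) *s b) = 0"
    using t(2) by (simp add: T_def scale_left_diff_distrib sum_subtractf)
  then have "B t b - f b = 0" if "b \<in> S" for b
    using independentD[OF S(2) fin subset_refl, of "\<lambda>b. B t b - f b" b] that by simp
  then have "S \<subseteq> {h \<in> H. B t h = f h}" using S(1) by auto
  moreover have "subspace {h \<in> H. B t h = f h}"
    using f subspace_H
    by (auto simp: subspace_def B_add B_scale B_zero dual_space_def) (metis add_0 add_cancel_right_right)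
  ultimately have "H \<subseteq> {h \<in> H. B t h = f h}" using span_minimal H_eq by blast
  then show "\<exists>t. t \<in> H \<and> (\<forall>h\<in>H. B t h = f h)" using t(1) by blast
qed

text \<open>The vector usually written \<open>t\<^sub>f\<close>.\<close>

definition riesz :: "('g \<Rightarrow> complex) \<Rightarrow> 'g" where
  "riesz f = (THE t. t \<in> H \<and> (\<forall>h\<in>H. B t h = f h))"

lemma riesz_in_H: "f \<in> D \<Longrightarrow> riesz f \<in> H"
  and B_riesz: "f \<in> D \<Longrightarrow> h \<in> H \<Longrightarrow> B (riesz f) h = f h"
  using theI'[OF dual_represented] by (auto simp: riesz_def)

abbreviation ip where "ip \<equiv> dual_form H B"

lemma ip_eq: "f \<in> D \<Longrightarrow> f' \<in> D \<Longrightarrow> ip f f' = f (riesz f')"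
  by (simp add: dual_form_def riesz_def[symmetric] riesz_in_H B_riesz)

lemma ip_sym: "ip f f' = ip f' f"
  by (simp add: dual_form_def B_sym)

lemma ip_add_left: "f \<in> D \<Longrightarrow> f' \<in> D \<Longrightarrow> k \<in> D \<Longrightarrow> ip (f + f') k = ip f k + ip f' k"
  by (simp add: ip_eq D_add)

lemma ip_add_right: "f \<in> D \<Longrightarrow> f' \<in> D \<Longrightarrow> k \<in> D \<Longrightarrow> ip k (f + f') = ip k f + ip k f'"
  by (simp add: ip_sym[of k] ip_add_left)

section \<open>Root strings\<close>

lemma br_weight_spaces:
  assumes "x \<in> weight_space \<beta>" "y \<in> weight_space \<gamma>"
  shows "br x y \<in> weight_space (\<beta> + \<gamma>)"
  unfolding weight_space_def
  using assms by (auto simp: br_derivation[of _ x y] weight_spaceD br_scale br_scale_left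
      scale_left_distrib)

text \<open>Both sides lie in \<open>H\<close> and have the same product with every \<open>h\<close> in \<open>H\<close>.\<close>

lemma br_opposite_weight_spaces:
  assumes \<alpha>: "\<alpha> \<in> D" and x: "x \<in> weight_space \<alpha>" and y: "y \<in> weight_space (- \<alpha>)"
  shows "br x y = B x y *s riesz \<alpha>"
proof -
  have H: "br x y \<in> H" using br_weight_spaces[OF x y] by (simp add: weight_space_0)
  have "br x y - B x y *s riesz \<alpha> = 0"
  proof (rule B_nondegenerate_on_H)
    show "br x y - B x y *s riesz \<alpha> \<in> H"
      using H riesz_in_H[OF \<alpha>] subspace_H by (simp add: subspace_diff subspace_scale)
    fix h assume h: "h \<in> H"
    have "B (br x y) h = \<alpha> h * B x y"
      using weight_spaceD[OF y h] by (simp add: B_invariant br_swap[of y h] B_minus B_scale)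
    then show "B (br x y - B x y *s riesz \<alpha>) h = 0"
      by (simp add: B_diff_left B_scale_left B_riesz \<alpha> h)
  qed
  then show ?thesis by simp
qed

text \<open>If a root vector \<open>x\<close> of weight \<open>\<alpha>\<close> were orthogonal to the weight space of \<open>- \<alpha>\<close>, it would be orthogonal to
  every weight space, against nondegeneracy. So some \<open>y\<close> of weight \<open>- \<alpha>\<close> has product \<open>1\<close> with \<open>x\<close>.\<close>

lemma obtains_root_pair:
  assumes \<alpha>: "\<alpha> \<in> \<Phi>"
  obtains x y where "x \<in> weight_space \<alpha>" "y \<in> weight_space (- \<alpha>)" "br x y = riesz \<alpha>"
proof -
  have D: "\<alpha> \<in> D" using \<alpha> by (simp add: roots_iff)
  obtain x where x: "x \<noteq> 0" "x \<in> weight_space \<alpha>" using \<alpha> by (auto simp: roots_iff)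
  have "\<exists>y\<in>weight_space (- \<alpha>). B x y \<noteq> 0"
  proof (rule ccontr)
    assume none: "\<not> ?thesis"
    have "B x z = 0" if "\<gamma> \<in> insert 0 \<Phi>" "z \<in> weight_space \<gamma>" for z \<gamma>
    proof (cases "\<gamma> = - \<alpha>")
      case False
      have "\<gamma> \<in> D" using that(1) D_zero by (auto simp: roots_iff)
      then obtain h where "h \<in> H" "\<alpha> h + \<gamma> h \<noteq> 0"
        using D_nonzero[of "\<alpha> + \<gamma>"] D False
        by (metis D_add add.commute eq_neg_iff_add_eq_0 plus_fun_apply)
      then show ?thesis using B_weight_spaces_orthogonal x(2) that(2) by blast
    qed (use none that in blast)
    then have "span (\<Union>\<gamma>\<in>insert 0 \<Phi>. weight_space \<gamma>) \<subseteq> {z. B x z = 0}"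
      by (intro span_minimal) (auto simp: subspace_def B_add B_scale B_zero)
    then have "x = 0" unfolding root_space_decomposition by (intro B_nondegenerate) auto
    then show False using x(1) by simp
  qed
  then obtain y where y: "y \<in> weight_space (- \<alpha>)" "B x y \<noteq> 0" by blast
  show ?thesis
  proof
    show "inverse (B x y) *s y \<in> weight_space (- \<alpha>)"
      by (rule subspace_scale[OF subspace_weight_space y(1)])
    show "br x (inverse (B x y) *s y) = riesz \<alpha>"
      using y(2) by (simp add: br_scale br_opposite_weight_spaces[OF D x(2) y(1)])
  qed (rule x(2))
qed

lemma br_funpow_weight_space:
  assumes "x \<in> weight_space \<alpha>" "v \<in> weight_space \<beta>"
  shows "(br x ^^ k) v \<in> weight_space (\<lambda>h. \<beta> h + of_nat k * \<alpha> h)"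
proof (induction k)
  case 0
  then show ?case using assms(2) by simp
next
  case (Suc k)
  have "(\<lambda>h. \<beta> h + of_nat (Suc k) * \<alpha> h) = \<alpha> + (\<lambda>h. \<beta> h + of_nat k * \<alpha> h)"
    by (auto simp: algebra_simps)
  then show ?case using br_weight_spaces[OF assms(1) Suc] by simp
qed

text \<open>The iterates have pairwise distinct weights, of which only finitely many occur.\<close>

lemma br_nilpotent_on_weight_vectors:
  assumes \<alpha>: "\<alpha> \<in> D" "\<alpha> \<noteq> 0" and x: "x \<in> weight_space \<alpha>" and \<beta>: "\<beta> \<in> D" and v: "v \<in> weight_space \<beta>"
  shows "\<exists>k. (br x ^^ k) v = 0"
proof (rule ccontr)
  assume nz: "\<not> ?thesis"
  define W where "W k = (\<lambda>h. \<beta> h + of_nat k * \<alpha> h)" for k :: nat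
  obtain h where h: "h \<in> H" "\<alpha> h \<noteq> 0" using D_nonzero \<alpha> by blast
  have "inj W"
  proof (rule injI)
    fix j k assume "W j = W k"
    then have "W j h = W k h" by simp
    then show "j = k" using h(2) by (simp add: W_def)
  qed
  moreover have "finite (range W)"
  proof (rule finite_weights)
    have "W k = \<beta> + (\<lambda>h. of_nat k * \<alpha> h)" for k by (auto simp: W_def)
    then show "range W \<subseteq> D" using D_add[OF \<beta> D_scale[OF \<alpha>(1)]] by auto
    show "\<exists>x. x \<noteq> 0 \<and> x \<in> weight_space \<gamma>" if "\<gamma> \<in> range W" for \<gamma>
      using that nz br_funpow_weight_space[OF x v] unfolding W_def by blast
  qed
  ultimately show False by (simp add: finite_image_iff)
qed

lemma obtains_last_nonzero_power:
  assumes \<alpha>: "\<alpha> \<in> D" "\<alpha> \<noteq> 0" and x: "x \<in> weight_space \<alpha>" and \<beta>: "\<beta> \<in> D" and v: "v \<in> weight_space \<beta>"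
    and "v \<noteq> 0"
  obtains k where "(br x ^^ k) v \<noteq> 0" "(br x ^^ Suc k) v = 0"
proof -
  define k where "k = (LEAST k. (br x ^^ k) v = 0)"
  have k: "(br x ^^ k) v = 0"
    unfolding k_def by (rule LeastI_ex) (rule br_nilpotent_on_weight_vectors[OF assms(1-5)])
  then obtain j where j: "k = Suc j" using \<open>v \<noteq> 0\<close> by (cases k) auto
  then have "(br x ^^ j) v \<noteq> 0" using not_less_Least[of j "\<lambda>k. (br x ^^ k) v = 0"] by (auto simp: k_def)
  then show ?thesis using k j that by blast
qed

text \<open>Going up from a root vector of weight \<open>\<beta>\<close> by \<open>x\<close> ends at a nonzero \<open>w\<close> with \<open>[x, w] = 0\<close>, of weight
  \<open>\<mu> = \<beta> + p \<alpha>\<close>. Going down from \<open>w\<close> by \<open>y\<close> ends after \<open>m\<close> steps, and applying \<open>x\<close> to the vanishing iterate gives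
  \<open>\<mu> h = m / 2 * \<alpha> h\<close> for \<open>h = [x, y]\<close>. The computation does not presuppose \<open>\<alpha> h \<noteq> 0\<close>, so that it can be
  used to prove that roots are not isotropic.\<close>

lemma root_pairing_rational:
  assumes \<alpha>: "\<alpha> \<in> \<Phi>" and \<beta>: "\<beta> \<in> \<Phi>"
  obtains r where "r \<in> \<rat>" "ip \<beta> \<alpha> = r * ip \<alpha> \<alpha>"
proof -
  have D: "\<alpha> \<in> D" "\<alpha> \<noteq> 0" "\<beta> \<in> D" using \<alpha> \<beta> by (auto simp: roots_iff)
  have D': "- \<alpha> \<in> D" "- \<alpha> \<noteq> 0" using D_minus D by auto
  obtain v where v: "v \<noteq> 0" "v \<in> weight_space \<beta>" using \<beta> by (auto simp: roots_iff)
  obtain x y where xy: "x \<in> weight_space \<alpha>" "y \<in> weight_space (- \<alpha>)" "br x y = riesz \<alpha>"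
    using obtains_root_pair[OF \<alpha>] by blast
  define h where "h = riesz \<alpha>"
  have h: "h \<in> H" using riesz_in_H D by (simp add: h_def)
  obtain p where p: "(br x ^^ p) v \<noteq> 0" "(br x ^^ Suc p) v = 0"
    using obtains_last_nonzero_power[OF D(1,2) xy(1) D(3) v(2,1)] by blast
  define w where "w = (br x ^^ p) v"
  define \<mu> where "\<mu> = (\<lambda>h. \<beta> h + of_nat p * \<alpha> h)"
  have w: "w \<in> weight_space \<mu>" "w \<noteq> 0" "br x w = 0"
    using br_funpow_weight_space[OF xy(1) v(2)] p by (auto simp: w_def \<mu>_def)
  have "\<mu> = \<beta> + (\<lambda>h. of_nat p * \<alpha> h)" by (auto simp: \<mu>_def)
  then have \<mu>: "\<mu> \<in> D" using D_add[OF D(3) D_scale[OF D(1)]] by simp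
  obtain m where m: "(br y ^^ m) w \<noteq> 0" "(br y ^^ Suc m) w = 0"
    using obtains_last_nonzero_power[OF D' xy(2) \<mu> w(1,2)] by blast
  have step: "br x (br y u) = (\<mu> h - of_nat k * \<alpha> h) *s u + br y (br x u)"
    if "u = (br y ^^ k) w" for u k
  proof -
    have "br h u = (\<mu> h - of_nat k * \<alpha> h) *s u"
      using weight_spaceD[OF br_funpow_weight_space[OF xy(2) w(1)] h, of k] by (simp add: that)
    then show ?thesis unfolding br_derivation[of x y u] xy(3) h_def by simp
  qed
  \<comment> \<open>Each step down contributes the weight of the vector it starts from, so the factor is the sum of \<open>\<mu> h - i \<alpha> h\<close> for \<open>i = 0, \<dots>, k\<close>.\<close>
  have ladder: "br x ((br y ^^ Suc k) w)
      = (of_nat (Suc k) * \<mu> h - of_nat (k * Suc k) / 2 * \<alpha> h) *s (br y ^^ k) w" for k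
  proof (induction k)
    case 0
    then show ?case using step[of w 0] w(3) by (simp add: br_zero)
  next
    case (Suc k)
    have "br x ((br y ^^ Suc (Suc k)) w)
       = (\<mu> h - of_nat (Suc k) * \<alpha> h) *s (br y ^^ Suc k) w + br y (br x ((br y ^^ Suc k) w))"
      using step[of "(br y ^^ Suc k) w" "Suc k"] by simp
    also have "\<dots> = (\<mu> h - of_nat (Suc k) * \<alpha> h) *s (br y ^^ Suc k) w
       + (of_nat (Suc k) * \<mu> h - of_nat (k * Suc k) / 2 * \<alpha> h) *s (br y ^^ Suc k) w"
      by (simp only: Suc.IH br_scale) simp
    also have "\<dots> = (of_nat (Suc (Suc k)) * \<mu> h - of_nat (Suc k * Suc (Suc k)) / 2 * \<alpha> h)
        *s (br y ^^ Suc k) w"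
      unfolding scale_left_distrib[symmetric]
      by (rule arg_cong[where f = "\<lambda>c. c *s (br y ^^ Suc k) w"]) (simp add: field_simps)
    finally show ?case .
  qed
  have "of_nat (Suc m) * \<mu> h - of_nat (m * Suc m) / 2 * \<alpha> h = 0"
    using ladder[of m] m by (simp add: br_zero)
  then have "of_nat (Suc m) * (\<mu> h - of_nat m / 2 * \<alpha> h) = 0" by (simp add: field_simps)
  then have "\<mu> h = of_nat m / 2 * \<alpha> h" by (metis mult_eq_0_iff of_nat_neq_0 right_minus_eq)
  then have "\<beta> h = (of_nat m / 2 - of_nat p) * \<alpha> h" by (simp add: \<mu>_def algebra_simps)
  then show ?thesis
    using D by (intro that[of "of_nat m / 2 - of_nat p"]) (simp_all add: ip_eq h_def)
qed

lemma ideal_trivial: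
  assumes "subspace I" "\<And>x y. y \<in> I \<Longrightarrow> br x y \<in> I" "z \<in> I" "z \<noteq> 0"
  shows "I = UNIV"
  using assms simple unfolding simple_lie_algebra_def lie_ideal_def by blast

text \<open>The center is an ideal, and it is not everything because a simple Lie algebra is not abelian.\<close>

lemma center_trivial:
  assumes "\<And>y. br y x = 0"
  shows "x = 0"
proof (rule ccontr)
  assume "x \<noteq> 0"
  then have "{z. \<forall>y. br y z = 0} = UNIV"
    using assms by (intro ideal_trivial) (auto simp: subspace_def br_add br_scale br_zero)
  then show False using simple unfolding simple_lie_algebra_def by blast
qed

lemma riesz_eq_0: "f \<in> D \<Longrightarrow> riesz f = 0 \<Longrightarrow> f = 0"
  by (rule dual_ext[OF _ D_zero]) (use B_riesz[of f] B_sym[of 0] B_zero in auto)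

text \<open>If \<open>(\<alpha>, \<alpha>) = 0\<close>, then all \<open>(\<gamma>, \<alpha>)\<close> with \<open>\<gamma>\<close> a root are zero by rationality of the ratio, so the vector
  representing \<open>\<alpha>\<close> acts as zero on all weight spaces and is central.\<close>

lemma root_not_isotropic:
  assumes \<alpha>: "\<alpha> \<in> \<Phi>"
  shows "ip \<alpha> \<alpha> \<noteq> 0"
proof
  assume iso: "ip \<alpha> \<alpha> = 0"
  have D: "\<alpha> \<in> D" "\<alpha> \<noteq> 0" using \<alpha> by (auto simp: roots_iff)
  have "br (riesz \<alpha>) z = 0" if "\<gamma> \<in> insert 0 \<Phi>" "z \<in> weight_space \<gamma>" for z \<gamma>
  proof -
    have "\<gamma> (riesz \<alpha>) = 0"
    proof (cases "\<gamma> = 0")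
      case False
      then have \<gamma>: "\<gamma> \<in> \<Phi>" using that by simp
      then obtain r where "ip \<gamma> \<alpha> = r * ip \<alpha> \<alpha>" using root_pairing_rational[OF \<alpha>] by blast
      then show ?thesis using iso \<gamma> D by (simp add: ip_eq roots_iff)
    qed simp
    then show ?thesis using weight_spaceD[OF that(2) riesz_in_H[OF D(1)]] by simp
  qed
  then have "span (\<Union>\<gamma>\<in>insert 0 \<Phi>. weight_space \<gamma>) \<subseteq> {z. br (riesz \<alpha>) z = 0}"
    by (intro span_minimal) (auto simp: subspace_def br_add br_scale br_zero)
  then have "br z (riesz \<alpha>) = 0" for z
    using br_swap[of z "riesz \<alpha>"] unfolding root_space_decomposition by auto
  then have "riesz \<alpha> = 0" by (rule center_trivial)
  then show False using riesz_eq_0 D by blast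
qed

section \<open>Rationality of root lengths\<close>

text \<open>The number \<open>(\<alpha>, \<beta>)\<close> is a rational multiple of both square lengths.\<close>

lemma rational_ratio_if_not_orthogonal:
  assumes \<alpha>: "\<alpha> \<in> \<Phi>" and \<beta>: "\<beta> \<in> \<Phi>" and "ip \<alpha> \<beta> \<noteq> 0"
  shows "ip \<alpha> \<alpha> / ip \<beta> \<beta> \<in> \<rat>"
proof -
  obtain r where r: "r \<in> \<rat>" "ip \<alpha> \<beta> = r * ip \<beta> \<beta>" using root_pairing_rational[OF \<beta> \<alpha>] by blast
  obtain s where s: "s \<in> \<rat>" "ip \<beta> \<alpha> = s * ip \<alpha> \<alpha>" using root_pairing_rational[OF \<alpha> \<beta>] by blast
  have eq: "r * ip \<beta> \<beta> = s * ip \<alpha> \<alpha>" using r(2) s(2) by (simp add: ip_sym)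
  have "ip \<beta> \<alpha> \<noteq> 0" using assms(3) by (simp add: ip_sym)
  then have "s \<noteq> 0" using s(2) by auto
  then have "ip \<alpha> \<alpha> / ip \<beta> \<beta> = r / s"
    using eq root_not_isotropic[OF \<beta>] by (simp add: field_simps)
  then show ?thesis using r(1) s(1) by simp
qed

text \<open>Irreducibility of the root system in the form that is needed. Let \<open>P\<close> be the set of roots whose square
  length is a rational multiple of that of \<open>\<beta>\<close>. A root outside \<open>P\<close> is orthogonal to \<open>P\<close>, hence the root spaces of \<open>P\<close> and
  the vectors representing \<open>P\<close> span an ideal. By simplicity this ideal is everything. A root outside \<open>P\<close> would be represented
  by a vector orthogonal to it.\<close>

lemma rational_root_length_ratio:
  assumes \<alpha>: "\<alpha> \<in> \<Phi>" and \<beta>: "\<beta> \<in> \<Phi>"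
  shows "ip \<alpha> \<alpha> / ip \<beta> \<beta> \<in> \<rat>"
proof -
  define P where "P = {\<gamma> \<in> \<Phi>. ip \<gamma> \<gamma> / ip \<beta> \<beta> \<in> \<rat>}"
  have P: "\<gamma> \<in> \<Phi>" "\<gamma> \<in> D" if "\<gamma> \<in> P" for \<gamma> using that by (auto simp: P_def roots_iff)
  have P_step: "\<delta> \<in> P" if "\<gamma> \<in> P" "\<delta> \<in> \<Phi>" "ip \<delta> \<gamma> \<noteq> 0" for \<gamma> \<delta>
  proof -
    have "ip \<delta> \<delta> / ip \<beta> \<beta> = (ip \<delta> \<delta> / ip \<gamma> \<gamma>) * (ip \<gamma> \<gamma> / ip \<beta> \<beta>)"
      using root_not_isotropic P(1)[OF that(1)] by simp
    moreover have "ip \<delta> \<delta> / ip \<gamma> \<gamma> \<in> \<rat>"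
      using rational_ratio_if_not_orthogonal that P by blast
    ultimately have "ip \<delta> \<delta> / ip \<beta> \<beta> \<in> \<rat>" using that(1) by (simp only: P_def mem_Collect_eq Rats_mult)
    then show ?thesis using that(2) by (simp add: P_def)
  qed
  have \<beta>P: "\<beta> \<in> P" using \<beta> root_not_isotropic[OF \<beta>] by (simp add: P_def)
  define G where "G = riesz ` P \<union> (\<Union>\<gamma>\<in>P. weight_space \<gamma>)"
  have root_vec: "z \<in> span G" if "z \<in> weight_space \<gamma>" "\<gamma> \<in> P" for z \<gamma>
    using that by (intro span_base) (auto simp: G_def)
  have riesz_P: "riesz \<gamma> \<in> span G" if "\<gamma> \<in> P" for \<gamma>
    using that by (intro span_base) (auto simp: G_def)
  have br_riesz: "br z (riesz \<gamma>) \<in> span G" if \<gamma>: "\<gamma> \<in> P" and \<delta>: "\<delta> \<in> insert 0 \<Phi>" and z: "z \<in> weight_space \<delta>" for z \<gamma> \<delta>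
  proof -
    have "br z (riesz \<gamma>) = - (\<delta> (riesz \<gamma>) *s z)"
      using weight_spaceD[OF z riesz_in_H[OF P(2)[OF \<gamma>]]] br_swap by metis
    moreover have "\<delta> (riesz \<gamma>) = 0 \<or> z \<in> span G"
    proof (cases "\<delta> = 0")
      case False
      then have "\<delta> \<in> \<Phi>" using \<delta> by simp
      then have "ip \<delta> \<gamma> = \<delta> (riesz \<gamma>)" using P(2)[OF \<gamma>] by (simp add: ip_eq roots_iff)
      then show ?thesis using P_step[OF \<gamma> \<open>\<delta> \<in> \<Phi>\<close>] root_vec[OF z] by auto
    qed simp
    ultimately show ?thesis by (auto simp: span_zero span_neg span_scale)
  qed
  have br_root: "br z x \<in> span G"
    if \<gamma>: "\<gamma> \<in> P" and x: "x \<in> weight_space \<gamma>" and \<delta>: "\<delta> \<in> insert 0 \<Phi>" and z: "z \<in> weight_space \<delta>" for x z \<gamma> \<delta>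
  proof -
    have sum: "br z x \<in> weight_space (\<gamma> + \<delta>)"
      using br_weight_spaces[OF z x] by (simp add: add.commute)
    have D: "\<gamma> \<in> D" "\<delta> \<in> D" using P(2)[OF \<gamma>] \<delta> D_zero by (auto simp: roots_iff)
    consider "\<delta> = 0" | "\<gamma> + \<delta> = 0" | "br z x = 0" | "\<delta> \<in> \<Phi>" "\<gamma> + \<delta> \<in> \<Phi>"
      using sum \<delta> D by (auto simp: roots_iff D_add)
    then show ?thesis
    proof cases
      case 1
      then show ?thesis using sum root_vec \<gamma> by simp
    next
      case 2
      then have "\<delta> = - \<gamma>" by (metis minus_unique)
      then have "br x z = B x z *s riesz \<gamma>" using br_opposite_weight_spaces[OF D(1) x] z by simp
      then show ?thesis
        using br_swap[of z x] riesz_P[OF \<gamma>] by (simp add: span_neg span_scale)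
    next
      case 3
      then show ?thesis by (simp add: span_zero)
    next
      case 4
      \<comment> \<open>Otherwise \<open>\<gamma> + \<delta>\<close> is orthogonal to \<open>\<gamma>\<close>, so \<open>\<delta>\<close> is not orthogonal to \<open>\<gamma>\<close> and lies in \<open>P\<close>; then \<open>\<gamma> + \<delta>\<close> is orthogonal to \<open>\<delta>\<close> too and is isotropic.\<close>
      have "\<gamma> + \<delta> \<in> P"
      proof (rule ccontr)
        assume nP: "\<gamma> + \<delta> \<notin> P"
        then have a: "ip (\<gamma> + \<delta>) \<gamma> = 0" using P_step[OF \<gamma> 4(2)] by blast
        then have "ip \<delta> \<gamma> = - ip \<gamma> \<gamma>" using D by (simp add: ip_add_left eq_neg_iff_add_eq_0 add.commute)
        then have "ip \<delta> \<gamma> \<noteq> 0" using root_not_isotropic P(1)[OF \<gamma>] by simp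
        then have "\<delta> \<in> P" by (rule P_step[OF \<gamma> 4(1)])
        then have "ip (\<gamma> + \<delta>) \<delta> = 0" using P_step[OF _ 4(2)] nP by blast
        with a have "ip (\<gamma> + \<delta>) (\<gamma> + \<delta>) = 0" using D by (simp add: ip_add_right D_add)
        then show False using root_not_isotropic 4(2) by blast
      qed
      then show ?thesis by (rule root_vec[OF sum])
    qed
  qed
  have "br z u \<in> span G" if u: "u \<in> span G" for z u
  proof -
    have "br z u \<in> span G" if u: "u \<in> G" for u
    proof -
      have "(\<Union>\<gamma>\<in>insert 0 \<Phi>. weight_space \<gamma>) \<subseteq> {z. br z u \<in> span G}"
        using u br_riesz br_root unfolding G_def by blast
      moreover have "subspace {z. br z u \<in> span G}"
        by (auto simp: subspace_def br_add_left br_scale_left br_zero_left span_add span_scale span_zero)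
      ultimately have "span (\<Union>\<gamma>\<in>insert 0 \<Phi>. weight_space \<gamma>) \<subseteq> {z. br z u \<in> span G}"
        by (rule span_minimal)
      then show ?thesis unfolding root_space_decomposition by blast
    qed
    then have "span G \<subseteq> {u. br z u \<in> span G}"
      by (intro span_minimal) (auto simp: subspace_def br_add br_scale br_zero span_add span_scale span_zero)
    then show ?thesis using u by blast
  qed
  moreover have "riesz \<beta> \<noteq> 0" using riesz_eq_0[of \<beta>] \<beta> by (auto simp: roots_iff)
  ultimately have UNIV: "span G = UNIV" using ideal_trivial[OF subspace_span] riesz_P[OF \<beta>P] by blast
  have "\<alpha> \<in> P"
  proof (rule ccontr)
    assume nP: "\<alpha> \<notin> P"
    have \<alpha>D: "\<alpha> \<in> D" "\<alpha> \<noteq> 0" using \<alpha> by (auto simp: roots_iff)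
    have "B (riesz \<alpha>) u = 0" if "u \<in> G" for u
      using that unfolding G_def
    proof
      assume "u \<in> riesz ` P"
      then obtain \<gamma> where "\<gamma> \<in> P" "u = riesz \<gamma>" by blast
      then show ?thesis
        using P_step[OF _ \<alpha>] nP P(2) \<alpha>D by (auto simp: ip_eq B_riesz riesz_in_H)
    next
      assume "u \<in> (\<Union>\<gamma>\<in>P. weight_space \<gamma>)"
      then obtain \<gamma> where \<gamma>: "\<gamma> \<in> P" "u \<in> weight_space \<gamma>" by blast
      have "\<gamma> \<noteq> 0" using P(1)[OF \<gamma>(1)] by (simp add: roots_iff)
      then obtain h where "h \<in> H" "\<gamma> h \<noteq> 0" using D_nonzero[OF P(2)[OF \<gamma>(1)]] by blast
      then show ?thesis
        using B_weight_spaces_orthogonal[of "riesz \<alpha>" 0 u \<gamma> h] \<gamma>(2) riesz_in_H[OF \<alpha>D(1)]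
        by (simp add: weight_space_0)
    qed
    then have "span G \<subseteq> {u. B (riesz \<alpha>) u = 0}"
      by (intro span_minimal) (auto simp: subspace_def B_add B_scale B_zero)
    then have "riesz \<alpha> = 0" unfolding UNIV by (intro B_nondegenerate) auto
    then show False using riesz_eq_0 \<alpha>D by blast
  qed
  then show ?thesis by (simp add: P_def)
qed

text \<open>There are finitely many roots, so a short one exists, and its square length is \<open>2\<close>.\<close>

lemma rational_root_length:
  assumes norm: "normalized_form \<Phi> ip" and \<alpha>: "\<alpha> \<in> \<Phi>"
  shows "ip \<alpha> \<alpha> \<in> \<rat>"
proof -
  have "finite \<Phi>" by (rule finite_weights) (auto simp: roots_iff)
  then obtain \<beta> where "\<beta> \<in> \<Phi>" "\<forall>\<gamma>\<in>\<Phi>. cmod (ip \<beta> \<beta>) \<le> cmod (ip \<gamma> \<gamma>)"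
    using ex_min_if_finite[of "(\<lambda>\<beta>. cmod (ip \<beta> \<beta>)) ` \<Phi>"] \<alpha> by (auto simp: not_less)
  then have "ip \<beta> \<beta> = 2" using norm by (auto simp: normalized_form_def short_root_def)
  with rational_root_length_ratio[OF \<alpha> \<open>\<beta> \<in> \<Phi>\<close>] have "ip \<alpha> \<alpha> / 2 * 2 \<in> \<rat>" by (intro Rats_mult) auto
  then show ?thesis by simp
qed

section \<open>Characters of the weight lattice\<close>

lemma int_span_subset_D:
  assumes "\<And>i. i \<in> {1..n} \<Longrightarrow> v i \<in> D"
  shows "int_span n v \<subseteq> D"
proof
  fix f assume "f \<in> int_span n v"
  then obtain k :: "nat \<Rightarrow> int" where f: "f = (\<lambda>z. \<Sum>i = 1..n. of_int (k i) * v i z)"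
    by (auto simp: int_span_def)
  show "f \<in> D"
    unfolding dual_space_def
  proof (intro CollectI conjI ballI allI impI)
    show "f (x + y) = f x + f y" if "x \<in> H" "y \<in> H" for x y
      using assms that by (simp add: f dual_space_def distrib_left sum.distrib)
    show "f (c *s x) = c * f x" if "x \<in> H" for x c
      using assms that by (simp add: f dual_space_def sum_distrib_left mult.left_commute)
    show "f x = 0" if "x \<notin> H" for x
      using assms that by (simp add: f dual_space_def)
  qed
qed

lemma ip_int_combination:
  fixes n :: nat and k :: "nat \<Rightarrow> int"
  assumes v: "\<And>i. i \<in> {1..n} \<Longrightarrow> v i \<in> D" and \<mu>: "\<mu> \<in> D"
  shows "ip (\<lambda>z. \<Sum>i = 1..n. of_int (k i) * v i z) \<mu> = (\<Sum>i = 1..n. of_int (k i) * ip (v i) \<mu>)"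
proof -
  have "(\<lambda>z. \<Sum>i = 1..n. of_int (k i) * v i z) \<in> D"
    using int_span_subset_D[of n v] v unfolding int_span_def by blast
  then show ?thesis using v \<mu> by (simp add: ip_eq)
qed

text \<open>The duality between the root lattice and a lattice on which the products with the simple roots have
  a common denominator \<open>s\<close>. The integers \<open>s * (\<alpha>\<^sub>j, \<mu>)\<close> modulo \<open>N = l * s\<close> describe the characters
  \<open>\<mu> \<mapsto> q^(\<alpha>\<^sub>j, \<mu>)\<close> as powers of a root of unity of order \<open>N\<close>.\<close>

lemma character_eq_pairing_with_lattice_vector:
  fixes s l :: nat
  assumes L: "subgroup L (add_grp UNIV)" "L \<subseteq> D" and \<alpha>: "\<And>j. j \<in> {1..n} \<Longrightarrow> \<alpha> j \<in> D"
    and l: "l > 0" and s: "s > 0"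
    and int: "\<And>j \<mu>. j \<in> {1..n} \<Longrightarrow> \<mu> \<in> L \<Longrightarrow> of_nat s * ip (\<alpha> j) \<mu> \<in> \<int>"
    and \<chi>: "\<And>x y. x \<in> L \<Longrightarrow> y \<in> L \<Longrightarrow> \<chi> (x + y) = \<chi> x * \<chi> y"
    and triv: "\<And>x. x \<in> cent l ip L (int_span n \<alpha>) \<Longrightarrow> \<chi> x = 1"
  shows "\<exists>\<beta>\<in>int_span n \<alpha>. \<forall>\<mu>\<in>L. \<chi> \<mu> = qpow l (ip \<beta> \<mu>)"
proof -
  \<comment> \<open>On \<open>L\<close> the floor of the real part recovers the integer; the value \<open>0\<close> at other \<open>j\<close> makes additivity hold for every \<open>j\<close>.\<close>
  define f where "f j \<mu> = (if j \<in> {1..n} then \<lfloor>Re (of_nat s * ip (\<alpha> j) \<mu>)\<rfloor> else 0)" for j \<mu>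
  have f: "of_int (f j \<mu>) = of_nat s * ip (\<alpha> j) \<mu>" if j: "j \<in> {1..n}" and \<mu>: "\<mu> \<in> L" for j \<mu>
  proof -
    obtain m where "of_nat s * ip (\<alpha> j) \<mu> = of_int m" using int[OF j \<mu>] by (auto elim: Ints_cases)
    then show ?thesis using j by (simp only: f_def if_True) simp
  qed
  have "\<exists>b. \<forall>\<mu>\<in>L. \<chi> \<mu> = unity_power (l * s) (\<Sum>j\<in>{1..n}. b j * f j \<mu>)"
  proof (rule character_trivial_on_common_kernel)
    show "f j (x + y) = f j x + f j y" if xy: "x \<in> L" "y \<in> L" for j x y
    proof (cases "j \<in> {1..n}")
      case True
      have "x + y \<in> L" by (rule add_subgroup_add[OF L(1) xy])
      then have "(of_int (f j (x + y)) :: complex) = of_int (f j x + f j y)"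
        using xy L(2) \<alpha>[OF True] by (simp add: f[OF True] ip_add_right subset_iff distrib_left)
      then show ?thesis unfolding of_int_eq_iff .
    next
      case False
      then have "f j z = 0" for z unfolding f_def by (rule if_not_P)
      then show ?thesis by simp
    qed
    show "\<chi> \<mu> = 1" if \<mu>: "\<mu> \<in> L" and dvd: "\<And>j. j \<in> {1..n} \<Longrightarrow> int (l * s) dvd f j \<mu>" for \<mu>
    proof (rule triv)
      have "\<exists>m::int. ip (\<alpha> j) \<mu> = of_nat l * of_int m" if j: "j \<in> {1..n}" for j
      proof -
        obtain m where "f j \<mu> = int (l * s) * m" using dvd[OF j] by (auto simp: dvd_def)
        then have "of_nat s * ip (\<alpha> j) \<mu> = of_nat s * (of_nat l * of_int m)"
          using f[OF j \<mu>] by auto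
        then have "ip (\<alpha> j) \<mu> = of_nat l * of_int m"
          using s by (metis mult_left_cancel neq0_conv of_nat_eq_0_iff)
        then show ?thesis ..
      qed
      then obtain m :: "nat \<Rightarrow> int" where m: "\<And>j. j \<in> {1..n} \<Longrightarrow> ip (\<alpha> j) \<mu> = of_nat l * of_int (m j)"
        by metis
      have "\<exists>k::int. ip \<mu> \<rho> = of_nat l * of_int k" if in_span: "\<rho> \<in> int_span n \<alpha>" for \<rho>
      proof -
        obtain b :: "nat \<Rightarrow> int" where \<rho>: "\<rho> = (\<lambda>z. \<Sum>i = 1..n. of_int (b i) * \<alpha> i z)"
          using in_span by (auto simp: int_span_def)
        have "ip \<mu> \<rho> = (\<Sum>j = 1..n. of_int (b j) * ip (\<alpha> j) \<mu>)"
          unfolding ip_sym[of \<mu>] \<rho> using \<mu> L(2) \<alpha> by (intro ip_int_combination) auto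
        also have "\<dots> = of_nat l * of_int (\<Sum>j = 1..n. b j * m j)"
          by (simp add: m sum_distrib_left mult.left_commute)
        finally show ?thesis ..
      qed
      then show "\<mu> \<in> cent l ip L (int_span n \<alpha>)" using \<mu> by (simp add: cent_def)
    qed
  qed (use L l s \<chi> add_subgroup_zero add_subgroup_diff in auto)
  then obtain b where b: "\<And>\<mu>. \<mu> \<in> L \<Longrightarrow> \<chi> \<mu> = unity_power (l * s) (\<Sum>j\<in>{1..n}. b j * f j \<mu>)"
    by blast
  define \<beta> where "\<beta> = (\<lambda>z. \<Sum>i = 1..n. of_int (b i) * \<alpha> i z)"
  have "\<chi> \<mu> = qpow l (ip \<beta> \<mu>)" if \<mu>: "\<mu> \<in> L" for \<mu>
  proof -
    have "of_int (\<Sum>j\<in>{1..n}. b j * f j \<mu>) = (\<Sum>j = 1..n. of_int (b j) * (of_nat s * ip (\<alpha> j) \<mu>))"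
      by (simp add: f \<mu>)
    also have "\<dots> = of_nat s * ip \<beta> \<mu>"
      using ip_int_combination[where v = \<alpha> and n = n and \<mu> = \<mu> and k = b] \<mu> L(2) \<alpha>
      by (auto simp: \<beta>_def sum_distrib_left mult.left_commute)
    finally have "\<chi> \<mu> = qpow (l * s) (of_nat s * ip \<beta> \<mu>)" using b[OF \<mu>] by simp
    also have "\<dots> = qpow l (ip \<beta> \<mu>)" using s by (simp add: qpow_def mult.assoc)
    finally show ?thesis .
  qed
  moreover have "\<beta> \<in> int_span n \<alpha>" unfolding \<beta>_def int_span_def by (rule rangeI)
  ultimately show ?thesis by blast
qed

text \<open>The half square lengths of the finitely many simple roots are rational, and every product of a simple
  root with a weight is an integral multiple of one of them.\<close>

lemma bounded_denominator_on_weights: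
  assumes norm: "normalized_form \<Phi> ip" and \<alpha>: "simple_roots \<Phi> n \<alpha>"
    and \<omega>: "fundamental_weights D ip n \<alpha> \<omega>"
  obtains s :: nat where "s > 0"
    "\<And>j \<mu>. j \<in> {1..n} \<Longrightarrow> \<mu> \<in> int_span n \<omega> \<Longrightarrow> of_nat s * ip (\<alpha> j) \<mu> \<in> \<int>"
proof -
  have \<alpha>\<Phi>: "\<alpha> i \<in> \<Phi>" if "i \<in> {1..n}" for i using \<alpha> that by (auto simp: simple_roots_def)
  have \<omega>D: "\<omega> i \<in> D" if "i \<in> {1..n}" for i using \<omega> that by (auto simp: fundamental_weights_def)
  have "(\<lambda>i. ip (\<alpha> i) (\<alpha> i) / 2) ` {1..n} \<subseteq> \<rat>"
    using rational_root_length[OF norm] \<alpha>\<Phi> by (auto intro!: Rats_divide)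
  then obtain s :: nat where s: "s > 0" "\<And>i. i \<in> {1..n} \<Longrightarrow> of_nat s * (ip (\<alpha> i) (\<alpha> i) / 2) \<in> \<int>"
    using common_denominator[of "(\<lambda>i. ip (\<alpha> i) (\<alpha> i) / 2) ` {1..n}"] by auto
  have "of_nat s * ip (\<alpha> j) \<mu> \<in> \<int>" if j: "j \<in> {1..n}" and \<mu>: "\<mu> \<in> int_span n \<omega>" for j \<mu>
  proof -
    obtain m :: "nat \<Rightarrow> int" where m: "\<mu> = (\<lambda>z. \<Sum>i = 1..n. of_int (m i) * \<omega> i z)"
      using \<mu> by (auto simp: int_span_def)
    have "ip (\<alpha> j) \<mu> = (\<Sum>i = 1..n. of_int (m i) * ip (\<omega> i) (\<alpha> j))"
      unfolding ip_sym[of "\<alpha> j"] m using \<omega>D \<alpha>\<Phi>[OF j] by (intro ip_int_combination) (auto simp: roots_iff)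
    also have "\<dots> = (\<Sum>i = 1..n. if i = j then of_int (m j) * (ip (\<alpha> j) (\<alpha> j) / 2) else 0)"
      using \<omega> j by (intro sum.cong) (auto simp: fundamental_weights_def)
    also have "\<dots> = of_int (m j) * (ip (\<alpha> j) (\<alpha> j) / 2)" using j by simp
    finally have "of_nat s * ip (\<alpha> j) \<mu> = of_int (m j) * (of_nat s * (ip (\<alpha> j) (\<alpha> j) / 2))"
      by (simp only: mult.left_commute)
    then show ?thesis using s(2)[OF j] by (metis Ints_mult Ints_of_int)
  qed
  then show ?thesis using s(1) that by blast
qed

end

section \<open>The radical of the form\<close>

theorem theorem3p12:
  fixes scale :: "complex \<Rightarrow> 'g::ab_group_add \<Rightarrow> 'g" and br :: "'g \<Rightarrow> 'g \<Rightarrow> 'g"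
    and H :: "'g set" and B :: "'g \<Rightarrow> 'g \<Rightarrow> complex"
    and n l :: nat and \<alpha> \<omega> :: "nat \<Rightarrow> 'g \<Rightarrow> complex"
    and \<Phi> R W L1 L2 L' :: "('g \<Rightarrow> complex) set"
    and ip :: "('g \<Rightarrow> complex) \<Rightarrow> ('g \<Rightarrow> complex) \<Rightarrow> complex"
    and g a :: "('g \<Rightarrow> complex) set \<Rightarrow> ('g \<Rightarrow> complex) set \<Rightarrow> complex"
    and A :: "('g \<Rightarrow> complex) \<Rightarrow> ('g \<Rightarrow> complex)"
    and C :: "('g \<Rightarrow> complex) set" and Rad :: "('g \<Rightarrow> complex) set set"
  assumes "simple_lie_algebra scale br" and "finite_dim scale"
    and "cartan_subalgebra scale br H"
    and "\<Phi> = roots scale br H" and "simple_roots \<Phi> n \<alpha>"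
    and "invariant_form scale br B" and "ip = dual_form H B" and "normalized_form \<Phi> ip"
    and "fundamental_weights (dual_space scale H) ip n \<alpha> \<omega>"
    and "R = int_span n \<alpha>" and "W = int_span n \<omega>"
    and "l \<ge> 1"
    and "intermediate_lattice R W L1" and "intermediate_lattice R W L2"
    and "cent l ip R L1 = L'" and "cent l ip R L2 = L'"
    and "pairing (quot L1 R) (quot L2 R) g"
    and "centralizer_transfer l ip R L2 A"
    and "a = a_form l ip R g A"
    and "C = cent_g l ip R g L1 L2"
    and "Rad = radical (quot L1 R) (quot L2 R) a"
  shows "(\<forall>\<nu>\<in>L1. \<forall>\<mu>\<in>L2.
            a (cls R \<nu>) (cls R \<mu>) = qpow l (- ip \<nu> (A \<mu>)) * g (cls R \<nu>) (cls R (A \<mu>)))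
       \<and> pairing (quot L1 R) (quot L2 R) a
       \<and> subgroup C (add_grp L1) \<and> L' \<lhd> add_grp C \<and> subgroup Rad (quot L1 R)
       \<and> (\<exists>\<phi> \<in> iso (quot C L') ((quot L1 R)\<lparr>carrier := Rad\<rparr>). \<forall>\<nu>\<in>C. \<phi> (cls L' \<nu>) = cls R \<nu>)"
proof -
  interpret cartan_data scale br H B
    using assms by unfold_locales auto
  have \<alpha>: "\<alpha> i \<in> dual_space scale H" if "i \<in> {1..n}" for i
  proof -
    have "\<alpha> i \<in> roots scale br H" using assms(4,5) that unfolding simple_roots_def by blast
    then show ?thesis by (simp add: roots_iff)
  qed
  have \<omega>: "\<omega> i \<in> dual_space scale H" if "i \<in> {1..n}" for i
    using assms that by (auto simp: fundamental_weights_def)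
  have WD: "W \<subseteq> dual_space scale H" using int_span_subset_D[OF \<omega>] assms by simp
  have L1: "subgroup L1 (add_grp UNIV)" "R \<subseteq> L1" "L1 \<subseteq> W"
    and L2: "subgroup L2 (add_grp UNIV)" "R \<subseteq> L2" "L2 \<subseteq> W"
    using assms by (auto simp: intermediate_lattice_def)
  obtain s :: nat where s: "s > 0"
    "\<And>j \<mu>. j \<in> {1..n} \<Longrightarrow> \<mu> \<in> W \<Longrightarrow> of_nat s * ip (\<alpha> j) \<mu> \<in> \<int>"
    using bounded_denominator_on_weights[of n \<alpha> \<omega>] assms by auto
  interpret T: transfer_pairing l ip "dual_space scale H" R L1 L2 g A
  proof (rule transfer_pairing.intro)
    show "\<exists>\<beta>\<in>R. \<forall>x\<in>L2. \<chi> x = qpow l (ip \<beta> x)"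
      if "\<And>x y. x \<in> L2 \<Longrightarrow> y \<in> L2 \<Longrightarrow> \<chi> (x + y) = \<chi> x * \<chi> y"
        "\<And>x. x \<in> cent l ip L2 R \<Longrightarrow> \<chi> x = 1" for \<chi>
      unfolding assms(10) assms(7)
      by (rule character_eq_pairing_with_lattice_vector[OF L2(1)])
        (use L2 WD \<alpha> s that assms in auto)
    show "subgroup R (add_grp UNIV)" using int_span_subgroup assms by simp
  qed (use assms L1 L2 WD ip_sym ip_add_left in auto)
  show ?thesis
    unfolding assms(19-21) assms(15)[symmetric]
    using T.a_cls T.pairing_a T.Rad_subgroup T.cent_normal T.ex_iso
      subgroup_add_grp[OF T.C_subgroup L1(1) T.C_subset]
    unfolding T.a_rep_def T.g_rep_def by blast
qed

end
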